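(* As formal power series in $t$ with integer coefficients, $$\sum_{\lambda,\mu,\nu}\left(c^{\lambda}_{\mu\nu}\right)^2t^{|\lambda|}=\prod_{k=1}^\infty\frac{1}{1-2t^k},$$ where the sum is over all triples $(\lambda,\mu,\nu)$ of partitions (the empty partition being allowed).
   Context: A partition $\lambda$ is a finite weakly decreasing sequence of positive integers (possibly empty), and $|\lambda|$ is the sum of its parts. The Littlewood–Richardson coefficients $c^\lambda_{\mu\nu}$ are the structure constants $s_\mu s_\nu=\sum_\lambda c^\lambda_{\mu\nu}s_\lambda$ of the ring of symmetric functions (in infinitely many variables) in the basis of Schur functions; in particular $c^\lambda_{\mu\nu}=0$ unless $|\lambda|=|\mu|+|\nu|$. *)

theory Defs
  imports
    "HOL-Library.FuncSet"
    "HOL-Library.Multiset"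
    "HOL-Computational_Algebra.Formal_Power_Series"
    "HOL-Analysis.Infinite_Sum"
    "HOL-Analysis.Infinite_Products"
begin

definition partitions :: "nat list set" where
  "partitions = {l. sorted_wrt (\<ge>) l \<and> (\<forall>p\<in>set l. 0 < p)}"

definition diagram :: "nat list \<Rightarrow> (nat \<times> nat) set" where
  "diagram l = {(i, j). i < length l \<and> j < l ! i}"

text \<open>
  Semistandard tableaux of shape \<open>l\<close>, with entries in \<open>nat\<close> (the index set of the variables).
  The fillings are extensional functions, so that distinct elements of this set are distinct
  tableaux.
\<close>

definition ssyt :: "nat list \<Rightarrow> (nat \<times> nat \<Rightarrow> nat) set" where
  "ssyt l = {T \<in> extensional (diagram l).
     (\<forall>i j j'. (i, j) \<in> diagram l \<longrightarrow> (i, j') \<in> diagram l \<longrightarrow> j < j' \<longrightarrow> T (i, j) \<le> T (i, j')) \<and>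
     (\<forall>i i' j. (i, j) \<in> diagram l \<longrightarrow> (i', j) \<in> diagram l \<longrightarrow> i < i' \<longrightarrow> T (i, j) < T (i', j))}"

text \<open>
  A formal power series over the integers in the variables \<open>x\<^sub>0, x\<^sub>1, \<dots>\<close> is given by its
  coefficients; the monomial \<open>x\<^sub>i \<cdots> x\<^sub>k\<close> is represented by the multiset \<open>{#i, \<dots>, k#}\<close> of
  its indices.  Hence multiplication of monomials is addition of multisets.
\<close>

type_synonym mseries = "nat multiset \<Rightarrow> int"

definition mseries_mult :: "mseries \<Rightarrow> mseries \<Rightarrow> mseries" where
  "mseries_mult f g = (\<lambda>a. \<Sum>b | b \<subseteq># a. f b * g (a - b))"

text \<open>
  The Schur function is the sum, over all semistandard tableaux \<open>T\<close> of shape \<open>l\<close>, of the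
  product of the variables \<open>x\<^bsub>T c\<^esub>\<close> over all cells \<open>c\<close>.
\<close>

definition schur :: "nat list \<Rightarrow> mseries" where
  "schur l = (\<lambda>a. int (card {T \<in> ssyt l. image_mset T (mset_set (diagram l)) = a}))"

definition schur_expansion :: "mseries \<Rightarrow> (nat list \<Rightarrow> int) \<Rightarrow> bool" where
  "schur_expansion f c \<longleftrightarrow>
     finite {l. c l \<noteq> 0} \<and> {l. c l \<noteq> 0} \<subseteq> partitions \<and>
     f = (\<lambda>a. \<Sum>l | c l \<noteq> 0. c l * schur l a)"

text \<open>
  \<open>lr_coeff l m n\<close> is the coefficient of \<open>schur l\<close> in the product of \<open>schur m\<close> and \<open>schur n\<close>.
  For partitions \<open>m\<close> and \<open>n\<close> the description is proper because the Schur functions of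
  partitions form a basis of the ring of symmetric functions over the integers.
\<close>

definition lr_coeff :: "nat list \<Rightarrow> nat list \<Rightarrow> nat list \<Rightarrow> int" where
  "lr_coeff l m n = (THE c. schur_expansion (mseries_mult (schur m) (schur n)) c) l"

text \<open>
  The type \<open>int\<close> is not of class \<open>inverse\<close>, so \<open>1 / f\<close> is not available on \<open>int fps\<close>.  For series
  with constant coefficient \<open>1\<close>, the multiplicative inverse is the following.
\<close>

definition fps_recip :: "int fps \<Rightarrow> int fps" where
  "fps_recip f = fps_right_inverse f 1"

lemma fps_recip: "fps_nth f 0 = 1 \<Longrightarrow> f * fps_recip f = 1"
  unfolding fps_recip_def by (rule fps_right_inverse) simp

end

theory Submission
  imports Defs
begin

text \<open>
  Let \<open>s\<^sub>l[2X]\<close> denote the Schur function of \<open>l\<close> with every variable doubled. The coefficient of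
  \<open>s\<^sub>l\<close> in \<open>s\<^sub>l[2X]\<close> is the sum of the squared Littlewood-Richardson coefficients of \<open>l\<close>, hence
  the sum in question in degree \<open>k\<close> is the trace of the operator \<open>f \<mapsto> f[2X]\<close> on symmetric functions
  of degree \<open>k\<close>. The products of complete symmetric functions form a second basis, related to the
  first one by the unitriangular Kostka matrix. There the diagonal entry at \<open>q\<close> is
  \<open>2 ^ length q\<close>, since each part of \<open>q\<close> goes as a whole to one of the two copies
  of the variables. Finally, the sum of \<open>2 ^ length q\<close> over the partitions \<open>q\<close> of \<open>k\<close> is the
  coefficient of the product.

  The link between the two bases is the Pieri rule. It is derived from the commutation relation
  of adding and removing horizontal strips, which has a bijective proof by reflection.
\<close>

section \<open>Horizontal strips\<close>

text \<open>That the same numbers govern multiplying Schur functions and splitting the variables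
  into two sets is usually read off from the scalar product. Here it comes from counting chains of
  horizontal strips. By the iterated Pieri rule, the chains from \<open>m\<close> to
  \<open>l\<close> give the coefficient of \<open>s_l\<close> in \<open>s_m\<close> times a product
  of complete functions. Since a tableau is itself a chain starting at the empty partition, cutting
  such a chain at \<open>m\<close> separates the two sets of variables. The inverse Kostka matrix
  converts both readings into the same coefficient \<open>lr m n l\<close>, and squares arise
  because doubling splits the variables and then multiplies. The Kostka matrix has integer entries
  and unit diagonal, so its inverse is integral and the trace argument stays within finite integer
  matrices, one degree at a time. Partitions are handled as weakly decreasing functions with finite
  support: every row then exists, possibly with length 0, and interlacing conditions need no case
  distinction on lengths.\<close>

definition pars :: "(nat \<Rightarrow> nat) set" where
  "pars = {p. antimono p \<and> finite {i. p i \<noteq> 0}}"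

definition psize :: "(nat \<Rightarrow> nat) \<Rightarrow> nat" where
  "psize p = (\<Sum>i | p i \<noteq> 0. p i)"

definition pars_le :: "nat \<Rightarrow> (nat \<Rightarrow> nat) set" where
  "pars_le n = {p \<in> pars. psize p \<le> n}"

definition pars_of :: "nat \<Rightarrow> (nat \<Rightarrow> nat) set" where
  "pars_of n = {p \<in> pars. psize p = n}"

text \<open>Interlacing of rows: the second inequality says that no column of \<open>p\<close>
  contains two cells outside \<open>q\<close>.\<close>

definition hstrip :: "(nat \<Rightarrow> nat) \<Rightarrow> (nat \<Rightarrow> nat) \<Rightarrow> bool" where
  "hstrip p q \<longleftrightarrow> (\<forall>i. q i \<le> p i \<and> p (Suc i) \<le> q i)"

text \<open>The matrix entry of multiplication by the complete symmetric function of degree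
  \<open>k\<close> in the Schur basis; read transposed, the entry of its adjoint.\<close>

definition strip :: "nat \<Rightarrow> (nat \<Rightarrow> nat) \<Rightarrow> (nat \<Rightarrow> nat) \<Rightarrow> int" where
  "strip k p q = of_bool (hstrip p q \<and> psize p = psize q + k)"

lemma psize_eq:
  assumes "\<And>i. N \<le> i \<Longrightarrow> p i = 0"
  shows "psize p = (\<Sum>i<N. p i)"
proof -
  have "{i. p i \<noteq> 0} \<subseteq> {..<N}" by (rule subsetI, rule ccontr) (simp add: assms)
  then show ?thesis unfolding psize_def by (intro sum.mono_neutral_left) auto
qed

lemma pars_bound:
  assumes "p \<in> pars"
  obtains N where "\<And>i. N \<le> i \<Longrightarrow> p i = 0"
proof -
  have "finite {i. p i \<noteq> 0}" using assms by (simp add: pars_def)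
  then obtain N where N: "\<forall>i\<in>{i. p i \<noteq> 0}. i < N"
    unfolding finite_nat_set_iff_bounded by blast
  show ?thesis
  proof (rule that)
    show "p i = 0" if "N \<le> i" for i using N that by (metis leD mem_Collect_eq)
  qed
qed

lemma antimono_parsD: "p \<in> pars \<Longrightarrow> i \<le> j \<Longrightarrow> p j \<le> p i"
  unfolding pars_def antimono_def by auto

lemma parsI: "(\<And>i. p (Suc i) \<le> p i) \<Longrightarrow> (\<And>i. N \<le> i \<Longrightarrow> p i = 0) \<Longrightarrow> p \<in> pars"
proof -
  assume a: "\<And>i. p (Suc i) \<le> p i" and b: "\<And>i. N \<le> i \<Longrightarrow> p i = 0"
  have "antimono p" by (rule antimonoI, rule lift_Suc_antimono_le[of p]) (rule a)
  moreover have "finite {i. p i \<noteq> 0}"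
    by (rule finite_subset[of _ "{..<N}"], rule subsetI, rule ccontr) (simp_all add: b)
  ultimately show "p \<in> pars" by (simp add: pars_def)
qed

lemma pars_entry_le: "p \<in> pars \<Longrightarrow> p i \<le> psize p"
  unfolding pars_def psize_def by (cases "p i = 0") (auto intro: member_le_sum)

text \<open>Otherwise each of the rows \<open>0..i\<close> would contribute at least one cell. This
  makes \<open>psize p\<close> itself a valid cutoff for finite sums over rows.\<close>

lemma pars_zero_beyond:
  assumes "p \<in> pars" "psize p \<le> i"
  shows "p i = 0"
proof (rule ccontr)
  assume nz: "p i \<noteq> 0"
  have "{..i} \<subseteq> {j. p j \<noteq> 0}"
  proof
    fix j assume "j \<in> {..i}"
    then show "j \<in> {j. p j \<noteq> 0}" using antimono_parsD[OF assms(1), of j i] nz by auto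
  qed
  then have "card {..i} \<le> card {j. p j \<noteq> 0}"
    using assms(1) by (intro card_mono) (auto simp: pars_def)
  also have "\<dots> \<le> (\<Sum>j | p j \<noteq> 0. p j)"
    unfolding card_eq_sum by (rule sum_mono) auto
  finally show False using assms(2) by (simp add: psize_def)
qed

lemma finite_pars_le [simp]: "finite (pars_le n)"
proof (rule finite_subset)
  show "pars_le n \<subseteq> {f. \<forall>x. (x \<in> {..<n} \<longrightarrow> f x \<in> {..n}) \<and> (x \<notin> {..<n} \<longrightarrow> f x = 0)}"
  proof
    fix p assume p: "p \<in> pars_le n"
    have "p i \<in> {..n}" for i using p pars_entry_le[of p i] by (auto simp: pars_le_def)
    moreover have "p i = 0" if "i \<notin> {..<n}" for i
      using pars_zero_beyond[of p i] p that by (auto simp: pars_le_def)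
    ultimately show "p \<in> {f. \<forall>x. (x \<in> {..<n} \<longrightarrow> f x \<in> {..n}) \<and> (x \<notin> {..<n} \<longrightarrow> f x = 0)}"
      by blast
  qed
qed (rule finite_set_of_finite_funs; simp)

lemma pars_of_subset: "n \<le> m \<Longrightarrow> pars_of n \<subseteq> pars_le m"
  unfolding pars_of_def pars_le_def by auto

lemma finite_pars_of [simp]: "finite (pars_of n)"
  by (rule finite_subset[OF pars_of_subset[OF order_refl] finite_pars_le])

lemma zero_pars [simp]: "(\<lambda>_. 0) \<in> pars" "psize (\<lambda>_. 0) = 0"
  by (auto simp: pars_def psize_def antimono_def)

lemma psize_0_iff: "p \<in> pars \<Longrightarrow> psize p = 0 \<longleftrightarrow> p = (\<lambda>_. 0)"
proof
  show "p = (\<lambda>_. 0)" if "p \<in> pars" "psize p = 0"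
    by (rule ext, rule pars_zero_beyond) (simp_all add: that)
qed simp

lemma hstrip_psize_le:
  assumes "hstrip p q" "p \<in> pars"
  shows "psize q \<le> psize p"
proof -
  obtain N where N: "\<And>i. N \<le> i \<Longrightarrow> p i = 0" using pars_bound[OF assms(2)] by metis
  then have N': "\<And>i. N \<le> i \<Longrightarrow> q i = 0" using assms(1) unfolding hstrip_def by (metis le_zero_eq)
  show ?thesis using psize_eq[of N p] psize_eq[of N q] N N' assms(1)
    by (auto simp: hstrip_def intro!: sum_mono)
qed

lemma hstrip_pars_lower:
  assumes "hstrip p q" "p \<in> pars"
  shows "q \<in> pars"
proof -
  obtain N where N: "\<And>i. N \<le> i \<Longrightarrow> p i = 0" using pars_bound[OF assms(2)] by metis
  then have N': "\<And>i. N \<le> i \<Longrightarrow> q i = 0" using assms(1) unfolding hstrip_def by (metis le_zero_eq)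
  show ?thesis
    by (rule parsI[of _ N]) (use assms(1) N' in \<open>simp_all add: hstrip_def, meson le_trans\<close>)
qed

lemma hstrip_pars_upper:
  assumes "hstrip p q" "q \<in> pars"
  shows "p \<in> pars"
proof -
  obtain N where N: "\<And>i. N \<le> i \<Longrightarrow> q i = 0" using pars_bound[OF assms(2)] by metis
  \<comment> \<open>A strip may open one new row below the support of \<open>q\<close>, hence the
    shift to \<open>Suc N\<close>.\<close>
  have N': "p i = 0" if "Suc N \<le> i" for i
    using N[of "i - 1"] that assms(1) unfolding hstrip_def
    by (cases i) (auto, metis le_zero_eq)
  show ?thesis
    by (rule parsI[of _ "Suc N"]) (use assms(1) N' in \<open>simp_all add: hstrip_def, meson le_trans\<close>)
qed

lemma hstrip_eq_size:
  assumes "hstrip p q" "p \<in> pars" "psize p = psize q"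
  shows "p = q"
proof -
  obtain N where N: "\<And>i. N \<le> i \<Longrightarrow> p i = 0" using pars_bound[OF assms(2)] by metis
  then have N': "\<And>i. N \<le> i \<Longrightarrow> q i = 0" using assms(1) unfolding hstrip_def by (metis le_zero_eq)
  have le: "q i \<le> p i" for i using assms(1) by (auto simp: hstrip_def)
  have "(\<Sum>i<N. p i) = (\<Sum>i<N. q i)"
    using psize_eq[of N p] psize_eq[of N q] N N' assms(3) by simp
  then have "q i = p i" if "i < N" for i
    using sum_mono_inv[of q "{..<N}" p] le that by auto
  then show ?thesis using N N' by (metis ext not_le)
qed

lemma hstrip_refl: "p \<in> pars \<Longrightarrow> hstrip p p"
  unfolding hstrip_def using antimono_parsD by auto

lemma strip_0: "p \<in> pars \<Longrightarrow> strip 0 p q = of_bool (p = q)"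
  unfolding strip_def using hstrip_eq_size hstrip_refl by auto

section \<open>Commutation of strips by reflecting intervals\<close>

lemma min_plus_max: "min a b + max a b = a + (b::nat)"
  by (simp add: min_def max_def)

lemma sum_of_bool_card: "finite S \<Longrightarrow> (\<Sum>x\<in>S. of_bool (P x)) = int (card {x\<in>S. P x})"
  by (simp add: of_bool_def sum.If_cases Int_def)

text \<open>
  If \<open>l\<close> interlaces both \<open>m\<close> and \<open>n\<close> from above, then \<open>l (Suc i)\<close> ranges over the same interval
  as \<open>r i\<close> for \<open>r\<close> interlacing both from below. Reflecting each of these intervals gives the
  bijection, and \<open>l 0 - max (m 0) (n 0)\<close> is the index \<open>i\<close>.
\<close>

lemma strip_down_up:
  assumes m: "m \<in> pars" and n: "n \<in> pars" and M: "psize m + k \<le> M" "psize n \<le> M"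
  shows "(\<Sum>l\<in>pars_le M. strip k l m * strip b l n) =
    (\<Sum>i\<le>min k b. \<Sum>r\<in>pars_le M. strip (b - i) m r * strip (k - i) n r)"
proof -
  define mx where "mx = (\<lambda>i. max (m i) (n i))"
  define mn where "mn = (\<lambda>i. min (m i) (n i))"
  define A where "A = {l\<in>pars_le M. (hstrip l m \<and> psize l = psize m + k) \<and> hstrip l n \<and> psize l = psize n + b}"
  define B where "B = (\<lambda>i. {r\<in>pars_le M. (hstrip m r \<and> psize m = psize r + (b - i)) \<and> hstrip n r \<and> psize n = psize r + (k - i)})"
  define f where "f = (\<lambda>l i. mn i + mx (Suc i) - l (Suc i))"
  define g where "g = (\<lambda>(j,r) i. case i of 0 \<Rightarrow> mx 0 + j | Suc i \<Rightarrow> mn i + mx (Suc i) - r i)"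
  have up: "hstrip l m \<and> hstrip l n \<longleftrightarrow> mx 0 \<le> l 0 \<and> (\<forall>i. mx (Suc i) \<le> l (Suc i) \<and> l (Suc i) \<le> mn i)"
    for l
  proof (intro iffI)
    assume "hstrip l m \<and> hstrip l n"
    then show "mx 0 \<le> l 0 \<and> (\<forall>i. mx (Suc i) \<le> l (Suc i) \<and> l (Suc i) \<le> mn i)" unfolding hstrip_def mx_def mn_def by simp
  next
    assume r: "mx 0 \<le> l 0 \<and> (\<forall>i. mx (Suc i) \<le> l (Suc i) \<and> l (Suc i) \<le> mn i)"
    have "m i \<le> l i \<and> n i \<le> l i" for i
      using r by (cases i) (simp_all add: mx_def)
    moreover have "l (Suc i) \<le> m i \<and> l (Suc i) \<le> n i" for i
      using r by (simp add: mn_def)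
    ultimately show "hstrip l m \<and> hstrip l n" unfolding hstrip_def by simp
  qed
  have dn: "hstrip m r \<and> hstrip n r \<longleftrightarrow> (\<forall>i. mx (Suc i) \<le> r i \<and> r i \<le> mn i)" for r
    unfolding hstrip_def mx_def mn_def by auto
  \<comment> \<open>Row 0 of \<open>l\<close> is not reflected and accounts for the excess
    \<open>l 0 - mx 0\<close>. Shifting the index of \<open>mx\<close> by one pairs
    \<open>mn i\<close> with \<open>mx i\<close>, whose sum is \<open>m i + n i\<close>.\<close>
  have sz: "psize r + psize l = (l 0 - mx 0) + psize m + psize n"
    if l: "l \<in> pars" and r: "r \<in> pars" and l0: "mx 0 \<le> l 0"
      and lr: "\<And>i. l (Suc i) + r i = mn i + mx (Suc i)" for l r
  proof -
    define N where "N = psize l + psize r + psize m + psize n"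
    have N: "\<And>i. N \<le> i \<Longrightarrow> l i = 0" "\<And>i. N \<le> i \<Longrightarrow> r i = 0"
      "\<And>i. N \<le> i \<Longrightarrow> m i = 0" "\<And>i. N \<le> i \<Longrightarrow> n i = 0"
      using pars_zero_beyond l r m n unfolding N_def by auto
    have "psize l = l 0 + (\<Sum>i<N. l (Suc i))"
      using psize_eq[of "Suc N" l] N by (simp add: sum.lessThan_Suc_shift del: sum.lessThan_Suc)
    moreover have "psize r = (\<Sum>i<N. r i)" using N by (intro psize_eq)
    ultimately have "psize r + psize l = l 0 + (\<Sum>i<N. mn i + mx (Suc i))"
      by (simp add: sum.distrib[symmetric] lr[symmetric] add.commute)
    also have "\<dots> = l 0 + (\<Sum>i<N. mn i) + (\<Sum>i<N. mx (Suc i))" by (simp add: sum.distrib)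
    also have "\<dots> + mx 0 = l 0 + (\<Sum>i<N. mn i) + (\<Sum>i<Suc N. mx i)"
      by (simp add: sum.lessThan_Suc_shift del: sum.lessThan_Suc)
    also have "(\<Sum>i<Suc N. mx i) = (\<Sum>i<N. mx i)" using N by (simp add: mx_def)
    also have "l 0 + (\<Sum>i<N. mn i) + (\<Sum>i<N. mx i) = l 0 + (\<Sum>i<N. m i + n i)"
      by (simp add: sum.distrib[symmetric] mx_def mn_def min_plus_max)
    also have "\<dots> = l 0 + psize m + psize n"
      using psize_eq[of N m] psize_eq[of N n] N by (simp add: sum.distrib)
    finally show ?thesis using l0 by simp
  qed
  have bij: "bij_betw (\<lambda>l. (l 0 - mx 0, f l)) A (Sigma {..min k b} B)"
  proof (rule bij_betw_byWitness[where f'=g])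
    show "\<forall>l\<in>A. g (l 0 - mx 0, f l) = l"
    proof
      fix l assume "l \<in> A"
      then have "mx 0 \<le> l 0" "mx (Suc i) \<le> l (Suc i)" "l (Suc i) \<le> mn i" for i
        using up[of l] by (auto simp: A_def)
      then show "g (l 0 - mx 0, f l) = l"
        by (simp add: g_def f_def fun_eq_iff trans_le_add1 split: nat.split)
    qed
    show "\<forall>x\<in>Sigma {..min k b} B. (g x 0 - mx 0, f (g x)) = x"
    proof
      fix x assume x: "x \<in> Sigma {..min k b} B"
      obtain j r where jr: "x = (j, r)" by (cases x)
      then have "mx (Suc i) \<le> r i" "r i \<le> mn i" for i
        using dn[of r] x by (auto simp: B_def)
      then show "(g x 0 - mx 0, f (g x)) = x"
        by (simp add: jr g_def f_def fun_eq_iff trans_le_add1)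
    qed
    show "(\<lambda>l. (l 0 - mx 0, f l)) ` A \<subseteq> Sigma {..min k b} B"
    proof (rule image_subsetI)
      fix l assume "l \<in> A"
      then have l: "l \<in> pars" "hstrip l m" "hstrip l n" "psize l = psize m + k" "psize l = psize n + b"
        unfolding A_def pars_le_def by auto
      then have u: "mx 0 \<le> l 0" "\<And>i. mx (Suc i) \<le> l (Suc i)" "\<And>i. l (Suc i) \<le> mn i"
        using up by auto
      have "hstrip m (f l) \<and> hstrip n (f l)"
        unfolding dn using u by (simp add: f_def le_diff_conv2 le_diff_conv trans_le_add1 add_mono)
      then have h: "hstrip m (f l)" "hstrip n (f l)" by auto
      have fp: "f l \<in> pars" using hstrip_pars_lower[OF h(1) m] .
      have s: "psize (f l) + psize l = (l 0 - mx 0) + psize m + psize n"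
        by (rule sz[OF l(1) fp u(1)]) (use u in \<open>simp_all add: f_def trans_le_add1\<close>)
      \<comment> \<open>Comparing these bounds with the size identity \<open>s\<close> forces the
        excess of row 0 to be at most \<open>b\<close> and at most \<open>k\<close>, which is the
        range of the index \<open>i\<close>.\<close>
      have "psize (f l) \<le> psize m" "psize (f l) \<le> psize n"
        using hstrip_psize_le h m n by auto
      moreover define d where "d = l 0 - mx 0"
      ultimately have d: "d \<le> k" "d \<le> b" "psize m = psize (f l) + (b - d)"
        "psize n = psize (f l) + (k - d)" "psize (f l) \<le> M"
        using s l(4,5) M by linarith+
      have "f l \<in> B d" unfolding B_def pars_le_def using d h fp by simp
      then show "(l 0 - mx 0, f l) \<in> Sigma {..min k b} B"
        using d(1,2) unfolding d_def[symmetric] by simp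
    qed
    show "g ` Sigma {..min k b} B \<subseteq> A"
    proof (rule image_subsetI)
      fix x assume x: "x \<in> Sigma {..min k b} B"
      obtain j r where jr: "x = (j, r)" by (cases x)
      then have j: "j \<in> {..min k b}" and "r \<in> B j" using x by auto
      then have r: "r \<in> pars" "hstrip m r" "hstrip n r" "psize m = psize r + (b - j)" "psize n = psize r + (k - j)"
        unfolding B_def pars_le_def by auto
      then have u: "\<And>i. mx (Suc i) \<le> r i" "\<And>i. r i \<le> mn i"
        using dn by auto
      have "hstrip (g (j,r)) m \<and> hstrip (g (j,r)) n"
        unfolding up using u by (simp add: g_def le_diff_conv2 le_diff_conv trans_le_add1 add_mono)
      then have h: "hstrip (g (j,r)) m" "hstrip (g (j,r)) n" by auto
      have gp: "g (j,r) \<in> pars" using hstrip_pars_upper[OF h(1) m] .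
      have s: "psize r + psize (g (j,r)) = (g (j,r) 0 - mx 0) + psize m + psize n"
        by (rule sz[OF gp r(1)]) (use u in \<open>auto simp: g_def trans_le_add1\<close>)
      moreover have "g (j,r) 0 - mx 0 = j" by (simp add: g_def)
      ultimately have "psize (g (j,r)) = psize m + k" "psize (g (j,r)) = psize n + b"
        using r(4,5) j by auto
      then show "g x \<in> A"
        using jr M h gp unfolding A_def pars_le_def by simp
    qed
  qed
  have "(\<Sum>l\<in>pars_le M. strip k l m * strip b l n) = int (card A)"
    unfolding strip_def A_def of_bool_conj[symmetric] by (simp only: sum_of_bool_card finite_pars_le)
  also have "card A = (\<Sum>i\<le>min k b. card (B i))"
    using bij_betw_same_card[OF bij] by (simp add: B_def)
  also have "int \<dots> = (\<Sum>i\<le>min k b. \<Sum>r\<in>pars_le M. strip (b - i) m r * strip (k - i) n r)"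
    unfolding strip_def B_def of_nat_sum of_bool_conj[symmetric]
    by (simp only: sum_of_bool_card finite_pars_le)
  finally show ?thesis .
qed

text \<open>Between fixed \<open>m\<close> and \<open>l\<close>, each row of the middle partition
  ranges over an interval independently of the other rows. Reflecting all intervals exchanges the
  two strip sizes; this is the Bender-Knuth involution seen on shapes. An inequality is enough, as
  the roles of \<open>a\<close> and \<open>b\<close> can be exchanged.\<close>

lemma strip_commute_aux:
  assumes m: "m \<in> pars" and l: "l \<in> pars"
  shows "card {r\<in>pars. (hstrip r m \<and> psize r = psize m + a) \<and> hstrip l r \<and> psize l = psize r + b}
       \<le> card {r\<in>pars. (hstrip r m \<and> psize r = psize m + b) \<and> hstrip l r \<and> psize l = psize r + a}"
    (is "card ?A \<le> card ?B")
proof (rule card_inj_on_le)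
  define lo where "lo = (\<lambda>i. max (m i) (l (Suc i)))"
  \<comment> \<open>Row 0 has no row of \<open>m\<close> above it, so only \<open>l 0\<close> bounds
    it.\<close>
  define hi where "hi = (\<lambda>i. case i of 0 \<Rightarrow> l 0 | Suc j \<Rightarrow> min (l i) (m j))"
  define f where "f = (\<lambda>r i. lo i + hi i - r i)"
  have iff: "hstrip r m \<and> hstrip l r \<longleftrightarrow> (\<forall>i. lo i \<le> r i \<and> r i \<le> hi i)"
    for r
  proof (intro iffI)
    assume h: "hstrip r m \<and> hstrip l r"
    have "lo i \<le> r i \<and> r i \<le> hi i" for i
      using h unfolding hstrip_def lo_def hi_def by (cases i) simp_all
    then show "\<forall>i. lo i \<le> r i \<and> r i \<le> hi i" ..
  next
    assume r: "\<forall>i. lo i \<le> r i \<and> r i \<le> hi i"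
    have "r (Suc i) \<le> m i \<and> r i \<le> l i" for i
      using spec[OF r, of "Suc i"] spec[OF r, of i] by (cases i) (simp_all add: hi_def)
    moreover have "m i \<le> r i \<and> l (Suc i) \<le> r i" for i
      using r by (simp add: lo_def)
    ultimately show "hstrip r m \<and> hstrip l r" unfolding hstrip_def by simp
  qed
  show "inj_on f ?A"
  proof (rule inj_on_inverseI[where g=f])
    fix r assume "r \<in> ?A"
    then have "lo i \<le> r i" "r i \<le> hi i" for i using iff by auto
    then show "f (f r) = r" unfolding f_def by (simp add: fun_eq_iff trans_le_add2)
  qed
  show "f ` ?A \<subseteq> ?B"
  proof
    fix r' assume "r' \<in> f ` ?A"
    then obtain r where r': "r' = f r" and r: "r \<in> pars" "hstrip r m" "hstrip l r"
      "psize r = psize m + a" "psize l = psize r + b" by auto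
    have u: "lo i \<le> r i" "r i \<le> hi i" for i using iff r by auto
    have "hstrip r' m \<and> hstrip l r'"
      unfolding iff r' f_def using u by (simp add: le_diff_conv2 trans_le_add2 le_diff_conv add_mono)
    then have h: "hstrip r' m" "hstrip l r'" by auto
    have rp: "r' \<in> pars" using hstrip_pars_upper[OF h(1) m] .
    define N where "N = psize l + psize r + psize m + psize r'"
    have N: "\<And>i. N \<le> i \<Longrightarrow> l i = 0" "\<And>i. N \<le> i \<Longrightarrow> r i = 0"
      "\<And>i. N \<le> i \<Longrightarrow> m i = 0" "\<And>i. N \<le> i \<Longrightarrow> r' i = 0"
      using pars_zero_beyond l r m rp unfolding N_def by auto
    \<comment> \<open>\<open>lo i\<close> and \<open>hi (Suc i)\<close> are the maximum and the
      minimum of the same two numbers, so the shifted sum of all interval ends involves only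
      \<open>m\<close> and \<open>l\<close>.\<close>
    have mm: "(\<Sum>i<N. max (m i) (l (Suc i))) + (\<Sum>i<N. min (l (Suc i)) (m i)) = (\<Sum>i<N. m i + l (Suc i))"
      unfolding sum.distrib[symmetric] by (rule sum.cong) (simp_all add: min_def max_def)
    have "psize r + psize r' = (\<Sum>i<Suc N. r i + r' i)"
      using psize_eq[of "Suc N" r] psize_eq[of "Suc N" r'] N by (simp add: sum.distrib)
    also have "\<dots> = (\<Sum>i<Suc N. lo i + hi i)"
      by (rule sum.cong) (use u in \<open>simp_all add: r' f_def trans_le_add2\<close>)
    also have "\<dots> = (\<Sum>i<Suc N. lo i) + (\<Sum>i<Suc N. hi i)" by (simp add: sum.distrib)
    also have "(\<Sum>i<Suc N. hi i) = l 0 + (\<Sum>i<N. min (l (Suc i)) (m i))"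
      by (simp add: sum.lessThan_Suc_shift hi_def del: sum.lessThan_Suc)
    also have "(\<Sum>i<Suc N. lo i) = (\<Sum>i<N. max (m i) (l (Suc i)))" using N by (simp add: lo_def)
    also have "(\<Sum>i<N. max (m i) (l (Suc i))) + (l 0 + (\<Sum>i<N. min (l (Suc i)) (m i)))
       = l 0 + (\<Sum>i<N. m i + l (Suc i))"
      using mm by (simp add: sum.distrib)
    also have "\<dots> = (\<Sum>i<N. m i) + (\<Sum>i<Suc N. l i)"
      by (simp add: sum.distrib sum.lessThan_Suc_shift del: sum.lessThan_Suc)
    also have "\<dots> = psize m + psize l"
      using psize_eq[of "Suc N" l] psize_eq[of N m] N by simp
    finally show "r' \<in> ?B" using r rp h by auto
  qed
  have "?B \<subseteq> pars_le (psize l)" unfolding pars_le_def by auto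
  then show "finite ?B" using finite_pars_le finite_subset by blast
qed

lemma strip_commute:
  assumes m: "m \<in> pars" and l: "l \<in> pars" "psize l \<le> M"
  shows "(\<Sum>r\<in>pars_le M. strip a r m * strip b l r) = (\<Sum>r\<in>pars_le M. strip b r m * strip a l r)"
proof -
  have "(\<Sum>r\<in>pars_le M. strip a r m * strip b l r) =
    int (card {r\<in>pars. (hstrip r m \<and> psize r = psize m + a) \<and> hstrip l r \<and> psize l = psize r + b})" for a b
  proof -
    have "{r\<in>pars. (hstrip r m \<and> psize r = psize m + a) \<and> hstrip l r \<and> psize l = psize r + b} =
      {r\<in>pars_le M. (hstrip r m \<and> psize r = psize m + a) \<and> hstrip l r \<and> psize l = psize r + b}"
      using l(2) unfolding pars_le_def by auto
    then show ?thesis unfolding strip_def of_bool_conj[symmetric]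
      by (simp only: sum_of_bool_card finite_pars_le)
  qed
  then show ?thesis using strip_commute_aux[OF m l(1), of a b] strip_commute_aux[OF m l(1), of b a] by simp
qed

section \<open>Tableaux\<close>

definition diag :: "(nat \<Rightarrow> nat) \<Rightarrow> (nat \<times> nat) set" where
  "diag p = {(i, j). j < p i}"

definition tableaux :: "(nat \<Rightarrow> nat) \<Rightarrow> (nat \<times> nat \<Rightarrow> nat) set" where
  "tableaux p = {T \<in> extensional (diag p).
     (\<forall>i j j'. (i, j) \<in> diag p \<longrightarrow> (i, j') \<in> diag p \<longrightarrow> j < j' \<longrightarrow> T (i, j) \<le> T (i, j')) \<and>
     (\<forall>i i' j. (i, j) \<in> diag p \<longrightarrow> (i', j) \<in> diag p \<longrightarrow> i < i' \<longrightarrow> T (i, j) < T (i', j))}"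

definition content :: "(nat \<Rightarrow> nat) \<Rightarrow> (nat \<times> nat \<Rightarrow> nat) \<Rightarrow> nat multiset" where
  "content p T = image_mset T (mset_set (diag p))"

definition sch :: "(nat \<Rightarrow> nat) \<Rightarrow> mseries" where
  "sch p a = int (card {T \<in> tableaux p. content p T = a})"

text \<open>The monomial whose exponent at variable \<open>i\<close> is \<open>p i\<close>. Thus
  \<open>sch p (shape_mset q)\<close> is the Kostka number of shape \<open>p\<close> and content
  \<open>q\<close>.\<close>

definition shape_mset :: "(nat \<Rightarrow> nat) \<Rightarrow> nat multiset" where
  "shape_mset p = image_mset fst (mset_set (diag p))"

lemma mem_diag [simp]: "(i, j) \<in> diag p \<longleftrightarrow> j < p i"
  by (simp add: diag_def)

lemma diag_Sigma:
  assumes "\<And>i. N \<le> i \<Longrightarrow> p i = 0"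
  shows "diag p = (SIGMA i:{..<N}. {..<p i})"
proof (rule set_eqI)
  fix c :: "nat \<times> nat"
  obtain i j where "c = (i, j)" by (cases c)
  then show "c \<in> diag p \<longleftrightarrow> c \<in> (SIGMA i:{..<N}. {..<p i})"
    using assms[of i] by (cases "i < N") simp_all
qed

lemma diag_eq: "p \<in> pars \<Longrightarrow> diag p = (SIGMA i:{..<psize p}. {..<p i})"
  by (rule diag_Sigma) (rule pars_zero_beyond)

lemma finite_diag [simp]: "p \<in> pars \<Longrightarrow> finite (diag p)"
  by (simp add: diag_eq)

lemma card_diag:
  assumes "p \<in> pars"
  shows "card (diag p) = psize p"
proof -
  have "card (diag p) = (\<Sum>i<psize p. p i)" by (simp add: diag_eq[OF assms])
  also have "\<dots> = psize p"
    by (rule psize_eq[symmetric]) (rule pars_zero_beyond[OF assms])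
  finally show ?thesis .
qed

lemma size_content: "p \<in> pars \<Longrightarrow> size (content p T) = psize p"
  by (simp add: content_def card_diag)

lemma count_shape_mset:
  assumes "p \<in> pars"
  shows "count (shape_mset p) i = p i"
proof -
  have "count (shape_mset p) i = card (fst -` {i} \<inter> diag p)"
    unfolding shape_mset_def count_image_mset card_eq_sum using assms by (intro sum.cong) simp_all
  also have "fst -` {i} \<inter> diag p = Pair i ` {..<p i}" by (auto simp: diag_def)
  finally show ?thesis by (simp add: card_image inj_on_def)
qed

lemma size_shape_mset: "p \<in> pars \<Longrightarrow> size (shape_mset p) = psize p"
  by (simp add: shape_mset_def card_diag)

lemma shape_mset_inj: "p \<in> pars \<Longrightarrow> q \<in> pars \<Longrightarrow> shape_mset p = shape_mset q \<Longrightarrow> p = q"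
  by (rule ext) (simp flip: count_shape_mset)

lemma tableauxD:
  assumes "T \<in> tableaux p"
  shows "T \<in> extensional (diag p)"
    "j' < p i \<Longrightarrow> j < j' \<Longrightarrow> T (i, j) \<le> T (i, j')"
    "p \<in> pars \<Longrightarrow> j < p i' \<Longrightarrow> i < i' \<Longrightarrow> T (i, j) < T (i', j)"
proof -
  show "T \<in> extensional (diag p)" using assms by (simp add: tableaux_def)
  show "T (i, j) \<le> T (i, j')" if "j' < p i" "j < j'"
    using assms that by (simp add: tableaux_def)
  assume "p \<in> pars" and j: "j < p i'" "i < i'"
  then have "j < p i" using antimono_parsD[of p i i'] by simp
  then show "T (i, j) < T (i', j)" using assms j by (simp add: tableaux_def)
qed

lemma tableaux_entry:
  assumes "p \<in> pars" "c \<in> diag p"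
  shows "T c \<in># content p T"
  using assms by (simp add: content_def)

lemma finite_tableaux_content [simp]:
  assumes "p \<in> pars"
  shows "finite {T \<in> tableaux p. content p T = a}"
proof (rule finite_subset)
  show "{T \<in> tableaux p. content p T = a} \<subseteq> (\<Pi>\<^sub>E c\<in>diag p. set_mset a)"
  proof
    fix T assume T: "T \<in> {T \<in> tableaux p. content p T = a}"
    show "T \<in> (\<Pi>\<^sub>E c\<in>diag p. set_mset a)"
    proof (rule PiE_I)
      show "T c \<in> set_mset a" if "c \<in> diag p" for c
        using T tableaux_entry[OF assms that, of T] by simp
      show "T c = undefined" if "c \<notin> diag p" for c
        using T extensional_arb[OF tableauxD(1) that] by simp
    qed
  qed
  show "finite (\<Pi>\<^sub>E c\<in>diag p. set_mset a)" using assms by (intro finite_PiE) simp_all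
qed

lemma sch_nonzeroD:
  assumes "sch p a \<noteq> 0" "p \<in> pars"
  obtains T where "T \<in> tableaux p" "content p T = a"
proof -
  have "{T \<in> tableaux p. content p T = a} \<noteq> {}"
    using assms unfolding sch_def by (auto simp del: Collect_empty_eq)
  then obtain T where "T \<in> {T \<in> tableaux p. content p T = a}" by blast
  then show ?thesis by (intro that[of T]) simp_all
qed

lemma sch_degree: "p \<in> pars \<Longrightarrow> sch p a \<noteq> 0 \<Longrightarrow> size a = psize p"
  by (erule sch_nonzeroD) (auto simp: size_content)

lemma sch_empty: "p \<in> pars \<Longrightarrow> sch p {#} = of_bool (p = (\<lambda>_. 0))"
proof (cases "p = (\<lambda>_. 0)")
  case True
  then have "{T \<in> tableaux p. content p T = {#}} = {\<lambda>_. undefined}"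
    by (auto simp: tableaux_def diag_def content_def)
  then show ?thesis using True by (simp add: sch_def)
next
  case False
  assume "p \<in> pars"
  then show ?thesis using False sch_degree[of p "{#}"] psize_0_iff[of p] by auto
qed

section \<open>Unitriangularity of the Kostka numbers\<close>

lemma tableaux_row_bound:
  assumes T: "T \<in> tableaux p" and p: "p \<in> pars" and j: "j < p i"
  shows "i \<le> T (i, j)"
  using j
proof (induction i)
  case (Suc i)
  then have "j < p i" using antimono_parsD[OF p, of i "Suc i"] by simp
  then have "i \<le> T (i, j)" by (rule Suc.IH)
  also have "\<dots> < T (Suc i, j)" using tableauxD(3)[OF T p Suc.prems] by simp
  finally show ?case by simp
qed simp

lemma sum_mset_content: "sum_mset (content p T) = (\<Sum>c\<in>diag p. T c)"
  by (simp add: content_def sum_unfold_sum_mset)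

lemma sum_mset_shape_mset: "sum_mset (shape_mset p) = (\<Sum>c\<in>diag p. fst c)"
  by (simp add: shape_mset_def sum_unfold_sum_mset)

lemma sum_shape_le:
  assumes T: "T \<in> tableaux p" and p: "p \<in> pars"
  shows "sum_mset (shape_mset p) \<le> sum_mset (content p T)"
    and "sum_mset (shape_mset p) = sum_mset (content p T) \<Longrightarrow> T = restrict fst (diag p)"
proof -
  have le: "fst c \<le> T c" if "c \<in> diag p" for c
    using that tableaux_row_bound[OF T p] by (cases c) simp
  then show "sum_mset (shape_mset p) \<le> sum_mset (content p T)"
    unfolding sum_mset_content sum_mset_shape_mset by (rule sum_mono)
  assume "sum_mset (shape_mset p) = sum_mset (content p T)"
  then have "fst c = T c" if "c \<in> diag p" for c
    using sum_mono_inv[of fst "diag p" T c] le that p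
    unfolding sum_mset_content sum_mset_shape_mset by simp
  then show "T = restrict fst (diag p)"
    using extensional_arb[OF tableauxD(1)[OF T]] by (intro ext) (simp add: restrict_def)
qed

lemma content_restrict_fst: "p \<in> pars \<Longrightarrow> content p (restrict fst (diag p)) = shape_mset p"
  unfolding content_def shape_mset_def by (rule image_mset_cong) simp

text \<open>
  The entries in row \<open>i\<close> of a tableau are at least \<open>i\<close>. Comparing the sums of the entries shows
  that the Kostka matrix is unitriangular.
\<close>

lemma sch_triangular:
  assumes p: "p \<in> pars" and q: "q \<in> pars" and nz: "sch p (shape_mset q) \<noteq> 0"
  shows "p = q \<or> sum_mset (shape_mset p) < sum_mset (shape_mset q)"
proof -
  obtain T where T: "T \<in> tableaux p" "content p T = shape_mset q"
    using sch_nonzeroD[OF nz p] .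
  show ?thesis
  proof (cases "sum_mset (shape_mset p) = sum_mset (shape_mset q)")
    case True
    then have "T = restrict fst (diag p)" using sum_shape_le(2)[OF T(1) p] T(2) by simp
    then have "shape_mset p = shape_mset q" using T(2) content_restrict_fst[OF p] by simp
    then show ?thesis using shape_mset_inj[OF p q] by simp
  next
    case False
    then show ?thesis using sum_shape_le(1)[OF T(1) p] T(2) by simp
  qed
qed

text \<open>Equality of the entry sums leaves only the tableau whose row \<open>i\<close> is filled
  with \<open>i\<close>.\<close>

lemma sch_shape_mset_self:
  assumes p: "p \<in> pars"
  shows "sch p (shape_mset p) = 1"
proof -
  have r: "restrict fst (diag p) \<in> tableaux p" by (simp add: tableaux_def)
  have u: "T = restrict fst (diag p)" if "T \<in> tableaux p" "content p T = shape_mset p" for T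
    by (rule sum_shape_le(2)[OF that(1) p]) (simp only: that(2))
  have "{T \<in> tableaux p. content p T = shape_mset p} = {restrict fst (diag p)}"
  proof (intro equalityI subsetI)
    fix T assume "T \<in> {T \<in> tableaux p. content p T = shape_mset p}"
    then show "T \<in> {restrict fst (diag p)}" using u[of T] by (simp only: mem_Collect_eq singleton_iff simp_thms)
  qed (simp add: r content_restrict_fst[OF p])
  then show ?thesis by (simp add: sch_def)
qed

section \<open>Removing the largest entry of a tableau\<close>

definition lower_shape :: "(nat \<Rightarrow> nat) \<Rightarrow> nat \<Rightarrow> (nat \<times> nat \<Rightarrow> nat) \<Rightarrow> nat \<Rightarrow> nat" where
  "lower_shape p N T i = (LEAST j. p i \<le> j \<or> N \<le> T (i, j))"

text \<open>Weak increase makes the cells of a row with entry below \<open>N\<close> an initial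
  segment. The disjunct \<open>p i \<le> j\<close> in \<open>lower_shape\<close> supplies its end
  when the whole row lies below \<open>N\<close>.\<close>

lemma less_lower_shape_iff:
  assumes "\<And>j j'. j' < p i \<Longrightarrow> j < j' \<Longrightarrow> T (i, j) \<le> T (i, j')"
  shows "j < lower_shape p N T i \<longleftrightarrow> j < p i \<and> T (i, j) < N"
proof
  assume "j < lower_shape p N T i"
  from not_less_Least[OF this[unfolded lower_shape_def]]
  show "j < p i \<and> T (i, j) < N" by simp
next
  assume j: "j < p i \<and> T (i, j) < N"
  show "j < lower_shape p N T i"
  proof (rule ccontr)
    assume c: "\<not> j < lower_shape p N T i"
    let ?P = "\<lambda>j. p i \<le> j \<or> N \<le> T (i, j)"
    have "?P (p i)" by simp
    then have "?P (LEAST j. ?P j)" by (rule LeastI[of ?P])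
    then have "?P (lower_shape p N T i)" by (simp only: lower_shape_def)
    then have "N \<le> T (i, lower_shape p N T i)" using c j by simp
    moreover have "T (i, lower_shape p N T i) \<le> T (i, j)"
      using assms[of j "lower_shape p N T i"] c j by (cases "lower_shape p N T i = j") simp_all
    ultimately show False using j by simp
  qed
qed

lemma size_filter_neq: "size (filter_mset (\<lambda>x. x \<noteq> N) a) + count a N = size a"
proof -
  have "a = filter_mset (\<lambda>x. x \<noteq> N) a + replicate_mset (count a N) N"
    by (rule multiset_eqI) simp
  from arg_cong[OF this, of size] show ?thesis by simp
qed

text \<open>Columns increase strictly and \<open>N\<close> is the largest entry that can occur, so
  the cells carrying \<open>N\<close> meet each column at most once and form a horizontal
  strip.\<close>

lemma lower_shape_strip:
  assumes p: "p \<in> pars" and T: "T \<in> tableaux p" "content p T = a"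
    and a: "set_mset a \<subseteq> {..<Suc N}"
  defines "q \<equiv> lower_shape p N T"
  shows "diag q = {c \<in> diag p. T c < N}" "q \<in> pars" "hstrip p q"
    "psize p = psize q + count a N" "restrict T (diag q) \<in> tableaux q"
    "content q (restrict T (diag q)) = filter_mset (\<lambda>x. x \<noteq> N) a"
proof -
  have q: "j < q i \<longleftrightarrow> j < p i \<and> T (i, j) < N" for i j
    unfolding q_def by (rule less_lower_shape_iff) (rule tableauxD(2)[OF T(1)])
  have ent: "T c \<le> N" if "c \<in> diag p" for c
  proof -
    have "T c \<in> {..<Suc N}" using tableaux_entry[OF p that, of T] T(2) a by blast
    then show ?thesis by simp
  qed
  show dq: "diag q = {c \<in> diag p. T c < N}" by (auto simp: q diag_def)
  show h: "hstrip p q"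
    unfolding hstrip_def
  proof (intro allI conjI)
    fix i
    show "q i \<le> p i" using q[of "p i" i] by (simp add: not_less[symmetric] del: not_less)
    show "p (Suc i) \<le> q i"
    proof (rule ccontr)
      assume "\<not> p (Suc i) \<le> q i"
      then have j: "q i < p (Suc i)" by simp
      then have "q i < p i" using antimono_parsD[OF p, of i "Suc i"] by simp
      moreover have "T (i, q i) < T (Suc i, q i)" using tableauxD(3)[OF T(1) p j] by simp
      moreover have "T (Suc i, q i) \<le> N" using ent j by simp
      ultimately show False using q[of "q i" i] by simp
    qed
  qed
  show qp: "q \<in> pars" by (rule hstrip_pars_lower[OF h p])
  have "content q (restrict T (diag q)) = image_mset T (mset_set (diag q))"
    unfolding content_def using qp by (intro image_mset_cong) simp
  also have "\<dots> = filter_mset (\<lambda>x. x < N) (content p T)"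
    unfolding dq content_def filter_mset_image_mset using p by (simp add: filter_mset_mset_set)
  also have "\<dots> = filter_mset (\<lambda>x. x \<noteq> N) a"
    unfolding T(2) by (rule filter_mset_cong) (use a in auto)
  finally show c: "content q (restrict T (diag q)) = filter_mset (\<lambda>x. x \<noteq> N) a" .
  show "psize p = psize q + count a N"
    using size_filter_neq[of N a] size_content[OF p, of T] size_content[OF qp, of "restrict T (diag q)"]
    unfolding c T(2) by simp
  show "restrict T (diag q) \<in> tableaux q"
    using tableauxD(2,3)[OF T(1)] p q unfolding tableaux_def by simp
qed

definition extend_tab :: "(nat \<Rightarrow> nat) \<Rightarrow> nat \<Rightarrow> (nat \<Rightarrow> nat) \<Rightarrow> (nat \<times> nat \<Rightarrow> nat) \<Rightarrow> nat \<times> nat \<Rightarrow> nat" where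
  "extend_tab p N q T = (\<lambda>c\<in>diag p. if c \<in> diag q then T c else N)"

lemma extend_tab:
  assumes p: "p \<in> pars" and h: "hstrip p q" and T: "T \<in> tableaux q" "content q T = filter_mset (\<lambda>x. x \<noteq> N) a"
    and a: "set_mset a \<subseteq> {..<Suc N}" and sz: "psize p = psize q + count a N"
  shows "extend_tab p N q T \<in> tableaux p" "content p (extend_tab p N q T) = a"
    "lower_shape p N (extend_tab p N q T) = q" "restrict (extend_tab p N q T) (diag q) = T"
proof -
  let ?E = "extend_tab p N q T"
  have q: "q \<in> pars" by (rule hstrip_pars_lower[OF h p])
  have qp: "q i \<le> p i" "p (Suc i) \<le> q i" for i using h by (simp_all add: hstrip_def)
  have sub: "diag q \<subseteq> diag p" using qp(1) by (auto simp: diag_def intro: less_le_trans)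
  have ent: "T c < N" if "c \<in> diag q" for c
  proof -
    have "T c \<in># filter_mset (\<lambda>x. x \<noteq> N) a" using tableaux_entry[OF q that, of T] T(2) by simp
    then have "T c \<in> {..<Suc N}" "T c \<noteq> N" using a by auto
    then show ?thesis by simp
  qed
  have E: "?E (i, j) = (if j < q i then T (i, j) else N)" if "j < p i" for i j
    using that by (simp add: extend_tab_def)
  have entN: "T (i, j) < N" if "j < q i" for i j using ent that by simp
  have rows: "?E (i, j) \<le> ?E (i, j')" if "j' < p i" "j < j'" for i j j'
    using that E[of j i] E[of j' i] entN[of j i] tableauxD(2)[OF T(1), of j' i j] by auto
  show "?E \<in> tableaux p"
    unfolding tableaux_def mem_Collect_eq
  proof (intro conjI allI impI)
    show "?E \<in> extensional (diag p)" by (simp add: extend_tab_def)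
    show "?E (i, j) \<le> ?E (i, j')" if "(i, j') \<in> diag p" "j < j'" for i j j'
      using rows that by simp
    show "?E (i, j) < ?E (i', j)" if "(i, j) \<in> diag p" "(i', j) \<in> diag p" "i < i'" for i i' j
    proof -
      \<comment> \<open>Of two cells in one column the upper one lies in \<open>q\<close>, because
        the strip has at most one cell per column; hence its entry is below
        \<open>N\<close>.\<close>
      have "p i' \<le> p (Suc i)" using antimono_parsD[OF p, of "Suc i" i'] that by simp
      then have "j < q i" using that(2) qp(2)[of i] by simp
      then show ?thesis
        using E[of j i] E[of j i'] entN[of j i] tableauxD(3)[OF T(1) q, of j i' i] that by auto
    qed
  qed
  have "content p ?E = image_mset ?E (mset_set (diag q \<union> (diag p - diag q)))"
    unfolding content_def using sub by (simp add: Un_absorb1)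
  also have "\<dots> = image_mset ?E (mset_set (diag q)) + image_mset ?E (mset_set (diag p - diag q))"
    using p q by (subst mset_set_Union) simp_all
  also have "image_mset ?E (mset_set (diag q)) = content q T"
    unfolding content_def using sub q by (intro image_mset_cong) (auto simp: extend_tab_def)
  also have "image_mset ?E (mset_set (diag p - diag q)) = image_mset (\<lambda>_. N) (mset_set (diag p - diag q))"
    using p by (intro image_mset_cong) (simp add: extend_tab_def)
  also have "\<dots> = replicate_mset (card (diag p - diag q)) N" by (simp add: image_mset_const_eq)
  also have "card (diag p - diag q) = count a N"
    using sub p q sz by (simp add: card_Diff_subset card_diag)
  also have "content q T + replicate_mset (count a N) N = a"
    unfolding T(2) by (rule multiset_eqI) simp
  finally show "content p ?E = a" .
  have c: "j < lower_shape p N ?E i \<longleftrightarrow> j < q i" for i j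
  proof -
    have "j < lower_shape p N ?E i \<longleftrightarrow> j < p i \<and> ?E (i, j) < N"
      by (rule less_lower_shape_iff) (rule rows)
    also have "\<dots> \<longleftrightarrow> j < q i" using E[of j i] entN[of j i] qp(1)[of i]
      by (cases "j < q i"; cases "j < p i") simp_all
    finally show ?thesis .
  qed
  show "lower_shape p N ?E = q"
  proof
    fix i show "lower_shape p N ?E i = q i"
      using c[of "q i" i] c[of "lower_shape p N ?E i" i] by simp
  qed
  show "restrict ?E (diag q) = T"
    using sub extensional_arb[OF tableauxD(1)[OF T(1)]]
    by (intro ext) (auto simp: extend_tab_def restrict_def)
qed

text \<open>Deleting the cells with entry \<open>N\<close> is a bijection onto pairs of a lower
  shape and a tableau of that shape. If \<open>N\<close> does not occur in \<open>a\<close>, the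
  strip is empty. The free bound \<open>M\<close> lets sums for different \<open>p\<close> share one
  index set.\<close>

lemma sch_branching:
  assumes p: "p \<in> pars" and M: "psize p \<le> M" and a: "set_mset a \<subseteq> {..<Suc N}"
  shows "sch p a = (\<Sum>q\<in>pars_le M. strip (count a N) p q * sch q (filter_mset (\<lambda>x. x \<noteq> N) a))"
proof -
  let ?a = "filter_mset (\<lambda>x. x \<noteq> N) a"
  define Q where "Q = {q \<in> pars_le M. hstrip p q \<and> psize p = psize q + count a N}"
  define B where "B = (\<lambda>q. {T \<in> tableaux q. content q T = ?a})"
  define A where "A = {T \<in> tableaux p. content p T = a}"
  have "bij_betw (\<lambda>T. (lower_shape p N T, restrict T (diag (lower_shape p N T)))) A (Sigma Q B)"
  proof (rule bij_betw_byWitness[where f' = "\<lambda>(q, T). extend_tab p N q T"])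
    show "\<forall>T\<in>A. (case (lower_shape p N T, restrict T (diag (lower_shape p N T))) of (q, T) \<Rightarrow> extend_tab p N q T) = T"
    proof
      fix T assume "T \<in> A"
      then have T: "T \<in> tableaux p" "content p T = a" by (simp_all add: A_def)
      have d: "diag (lower_shape p N T) = {c \<in> diag p. T c < N}" by (rule lower_shape_strip(1)[OF p T a])
      have le: "T c \<le> N" if "c \<in> diag p" for c
      proof -
        have "T c \<in> {..<Suc N}" using tableaux_entry[OF p that, of T] T(2) a by blast
        then show ?thesis by simp
      qed
      have "extend_tab p N (lower_shape p N T) (restrict T (diag (lower_shape p N T))) c = T c" for c
      proof (cases "c \<in> diag p")
        case True
        then have "extend_tab p N (lower_shape p N T) (restrict T (diag (lower_shape p N T))) c = (if T c < N then T c else N)"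
          unfolding extend_tab_def d by simp
        then show ?thesis using le[OF True] by simp
      next
        case False
        then show ?thesis using extensional_arb[OF tableauxD(1)[OF T(1)] False]
          by (simp add: extend_tab_def)
      qed
      then show "(case (lower_shape p N T, restrict T (diag (lower_shape p N T))) of (q, T) \<Rightarrow> extend_tab p N q T) = T"
        by (simp add: fun_eq_iff)
    qed
    show "\<forall>x\<in>Sigma Q B. (lower_shape p N (case x of (q, T) \<Rightarrow> extend_tab p N q T),
        restrict (case x of (q, T) \<Rightarrow> extend_tab p N q T)
          (diag (lower_shape p N (case x of (q, T) \<Rightarrow> extend_tab p N q T)))) = x"
    proof
      fix x assume x: "x \<in> Sigma Q B"
      obtain q T where [simp]: "x = (q, T)" by (cases x)
      have h: "hstrip p q" "T \<in> tableaux q" "content q T = ?a" "psize p = psize q + count a N"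
        using x by (simp_all add: Q_def B_def)
      show "(lower_shape p N (case x of (q, T) \<Rightarrow> extend_tab p N q T),
        restrict (case x of (q, T) \<Rightarrow> extend_tab p N q T)
          (diag (lower_shape p N (case x of (q, T) \<Rightarrow> extend_tab p N q T)))) = x"
        using extend_tab(3,4)[OF p h(1-3) a h(4)] by simp
    qed
    show "(\<lambda>T. (lower_shape p N T, restrict T (diag (lower_shape p N T)))) ` A \<subseteq> Sigma Q B"
    proof (rule image_subsetI)
      fix T assume "T \<in> A"
      then have T: "T \<in> tableaux p" "content p T = a" by (simp_all add: A_def)
      note c = lower_shape_strip[OF p T a]
      show "(lower_shape p N T, restrict T (diag (lower_shape p N T))) \<in> Sigma Q B"
        using c(2-6) M by (simp add: Q_def B_def pars_le_def)
    qed
    show "(\<lambda>(q, T). extend_tab p N q T) ` Sigma Q B \<subseteq> A"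
    proof (rule image_subsetI)
      fix x assume x: "x \<in> Sigma Q B"
      obtain q T where [simp]: "x = (q, T)" by (cases x)
      have h: "hstrip p q" "T \<in> tableaux q" "content q T = ?a" "psize p = psize q + count a N"
        using x by (simp_all add: Q_def B_def)
      show "(case x of (q, T) \<Rightarrow> extend_tab p N q T) \<in> A"
        using extend_tab(1,2)[OF p h(1-3) a h(4)] by (simp add: A_def)
    qed
  qed
  then have "card A = card (Sigma Q B)" by (rule bij_betw_same_card)
  also have "\<dots> = (\<Sum>q\<in>Q. card (B q))"
  proof (rule card_SigmaI)
    show "finite Q" by (simp add: Q_def)
    show "\<forall>q\<in>Q. finite (B q)" by (simp add: Q_def B_def pars_le_def)
  qed
  finally have "sch p a = (\<Sum>q\<in>Q. sch q ?a)"
    by (simp add: sch_def A_def B_def)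
  also have "\<dots> = (\<Sum>q\<in>pars_le M. strip (count a N) p q * sch q ?a)"
    unfolding Q_def strip_def by (rule sum.mono_neutral_cong_left) simp_all
  finally show ?thesis .
qed

section \<open>The Pieri rule\<close>

definition complete_sym :: "nat \<Rightarrow> mseries" where
  "complete_sym k a = of_bool (size a = k)"

definition mseries_one :: mseries where
  "mseries_one a = of_bool (a = {#})"

lemma finite_submultisets [simp]: "finite {b. b \<subseteq># a}"
proof (induction a)
  case (add x a)
  have "{b. b \<subseteq># add_mset x a} \<subseteq> {b. b \<subseteq># a} \<union> add_mset x ` {b. b \<subseteq># a}"
  proof
    fix b assume "b \<in> {b. b \<subseteq># add_mset x a}"
    then have b: "b - {#x#} \<subseteq># a" by (simp add: subset_eq_diff_conv)
    show "b \<in> {b. b \<subseteq># a} \<union> add_mset x ` {b. b \<subseteq># a}"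
    proof (cases "x \<in># b")
      case True
      then have "b = add_mset x (b - {#x#})" by simp
      then show ?thesis using b by blast
    next
      case False
      then show ?thesis using b by (simp add: diff_single_trivial)
    qed
  qed
  then show ?case by (rule finite_subset) (simp add: add.IH)
qed simp

lemma mseries_mult_one_right: "mseries_mult f mseries_one = f"
proof
  fix a
  have "mseries_mult f mseries_one a = (\<Sum>b\<in>{a}. f b * mseries_one (a - b))"
    unfolding mseries_mult_def
  proof (rule sum.mono_neutral_right)
    show "\<forall>b\<in>{b. b \<subseteq># a} - {a}. f b * mseries_one (a - b) = 0"
    proof
      fix b assume b: "b \<in> {b. b \<subseteq># a} - {a}"
      then have "\<not> a \<subseteq># b" using subset_mset.antisym[of a b] by auto
      then show "f b * mseries_one (a - b) = 0"
        by (simp add: mseries_one_def Diff_eq_empty_iff_mset)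
    qed
  qed simp_all
  then show "mseries_mult f mseries_one a = f a" by (simp add: mseries_one_def)
qed

lemma mseries_mult_one_left: "mseries_mult mseries_one f = f"
proof
  fix a
  have "mseries_mult mseries_one f a = (\<Sum>b\<in>{{#}}. mseries_one b * f (a - b))"
    unfolding mseries_mult_def
    by (rule sum.mono_neutral_right) (auto simp: mseries_one_def)
  then show "mseries_mult mseries_one f a = f a" by (simp add: mseries_one_def)
qed

lemma mseries_mult_sum_left:
  "mseries_mult (\<lambda>a. \<Sum>x\<in>X. c x * f x a) g = (\<lambda>a. \<Sum>x\<in>X. c x * mseries_mult (f x) g a)"
  unfolding mseries_mult_def sum_distrib_left sum_distrib_right
  by (rule ext, subst sum.swap) (simp only: mult.assoc)

lemma mseries_mult_sum_right:
  "mseries_mult g (\<lambda>a. \<Sum>x\<in>X. c x * f x a) = (\<lambda>a. \<Sum>x\<in>X. c x * mseries_mult g (f x) a)"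
  unfolding mseries_mult_def sum_distrib_left sum_distrib_right
  by (rule ext, subst sum.swap) (simp only: mult.left_commute)

text \<open>Both sides sum over the ordered factorisations of a monomial into three factors; only
  the parametrisation differs.\<close>

lemma mseries_mult_assoc: "mseries_mult (mseries_mult f g) h = mseries_mult f (mseries_mult g h)"
proof
  fix a :: "nat multiset"
  have "mseries_mult (mseries_mult f g) h a =
    (\<Sum>(b, c)\<in>(SIGMA b:{b. b \<subseteq># a}. {c. c \<subseteq># b}). f c * g (b - c) * h (a - b))"
    unfolding mseries_mult_def sum_distrib_right by (subst sum.Sigma) simp_all
  also have "\<dots> = (\<Sum>(c, d)\<in>(SIGMA c:{c. c \<subseteq># a}. {d. d \<subseteq># a - c}). f c * g d * h (a - c - d))"
  proof (rule sum.reindex_bij_witness[where i = "\<lambda>(c, d). (c + d, c)" and j = "\<lambda>(b, c). (c, b - c)"])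
    fix x assume "x \<in> (SIGMA b:{b. b \<subseteq># a}. {c. c \<subseteq># b})"
    then obtain b c where x: "x = (b, c)" "b \<subseteq># a" "c \<subseteq># b" by auto
    then have ca: "c \<subseteq># a" by (meson subset_mset.order_trans)
    show "(case case x of (b, c) \<Rightarrow> (c, b - c) of (c, d) \<Rightarrow> (c + d, c)) = x" using x by simp
    show "(case x of (b, c) \<Rightarrow> (c, b - c)) \<in> (SIGMA c:{c. c \<subseteq># a}. {d. d \<subseteq># a - c})"
      using x ca by (simp add: subseteq_mset_def diff_le_mono)
    have d: "a - c - (b - c) = a - b"
    proof (rule multiset_eqI)
      show "count (a - c - (b - c)) y = count (a - b) y" for y
        using mset_subset_eq_count[OF x(3), of y] by simp
    qed
    show "(case case x of (b, c) \<Rightarrow> (c, b - c) of (c, d) \<Rightarrow> f c * g d * h (a - c - d)) =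
      (case x of (b, c) \<Rightarrow> f c * g (b - c) * h (a - b))"
      by (simp only: x(1) case_prod_conv d)
  next
    fix y assume "y \<in> (SIGMA c:{c. c \<subseteq># a}. {d. d \<subseteq># a - c})"
    then obtain c d where y: "y = (c, d)" "c \<subseteq># a" "d \<subseteq># a - c" by auto
    show "(case case y of (c, d) \<Rightarrow> (c + d, c) of (b, c) \<Rightarrow> (c, b - c)) = y" using y by simp
    have "c + d \<subseteq># a" 
    proof (rule mset_subset_eqI)
      show "count (c + d) z \<le> count a z" for z
        using mset_subset_eq_count[OF y(2), of z] mset_subset_eq_count[OF y(3), of z] by simp
    qed
    then show "(case y of (c, d) \<Rightarrow> (c + d, c)) \<in> (SIGMA b:{b. b \<subseteq># a}. {c. c \<subseteq># b})"
      using y by simp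
  qed
  also have "\<dots> = mseries_mult f (mseries_mult g h) a"
    unfolding mseries_mult_def sum_distrib_left by (subst sum.Sigma) (simp_all add: mult.assoc)
  finally show "mseries_mult (mseries_mult f g) h a = mseries_mult f (mseries_mult g h) a" .
qed

section \<open>Splitting off one variable\<close>

lemma sum_submultiset_split:
  "(\<Sum>b | b \<subseteq># a. F b) =
    (\<Sum>i\<le>count a N. \<Sum>b | b \<subseteq># filter_mset (\<lambda>x. x \<noteq> N) a. F (b + replicate_mset i N))"
proof -
  let ?S = "{..count a N} \<times> {b. b \<subseteq># filter_mset (\<lambda>x. x \<noteq> N) a}"
  have "(\<Sum>b | b \<subseteq># a. F b) = (\<Sum>(i, b)\<in>?S. F (b + replicate_mset i N))"
  proof (rule sum.reindex_bij_witness[where i = "\<lambda>(i, b). b + replicate_mset i N"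
        and j = "\<lambda>b. (count b N, filter_mset (\<lambda>x. x \<noteq> N) b)"])
    fix b assume b: "b \<in> {b. b \<subseteq># a}"
    have eq: "filter_mset (\<lambda>x. x \<noteq> N) b + replicate_mset (count b N) N = b"
      by (rule multiset_eqI) simp
    then show "(case (count b N, filter_mset (\<lambda>x. x \<noteq> N) b) of (i, b) \<Rightarrow> b + replicate_mset i N) = b"
      by simp
    show "(count b N, filter_mset (\<lambda>x. x \<noteq> N) b) \<in> ?S"
      using b by (simp add: subseteq_mset_def)
    show "(case (count b N, filter_mset (\<lambda>x. x \<noteq> N) b) of (i, b) \<Rightarrow> F (b + replicate_mset i N)) = F b"
      using eq by simp
  next
    fix x assume "x \<in> ?S"
    then obtain i b where x: "x = (i, b)" "i \<le> count a N" "b \<subseteq># filter_mset (\<lambda>x. x \<noteq> N) a" by auto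
    have c: "count b y \<le> (if y = N then 0 else count a y)" for y
      using mset_subset_eq_count[OF x(3), of y] by (cases "y = N") simp_all
    have cN: "count b N = 0" using c[of N] by simp
    have "filter_mset (\<lambda>x. x \<noteq> N) (b + replicate_mset i N) = b"
      by (rule multiset_eqI) (simp add: cN)
    then show "(count (case x of (i, b) \<Rightarrow> b + replicate_mset i N) N,
        filter_mset (\<lambda>x. x \<noteq> N) (case x of (i, b) \<Rightarrow> b + replicate_mset i N)) = x"
      by (simp add: x(1) cN)
    have "count (b + replicate_mset i N) y \<le> count a y" for y
      using c[of y] x(2) by (cases "y = N") simp_all
    then show "(case x of (i, b) \<Rightarrow> b + replicate_mset i N) \<in> {b. b \<subseteq># a}"
      by (simp only: x(1) case_prod_conv mem_Collect_eq subseteq_mset_def) simp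
  qed
  also have "\<dots> = (\<Sum>i\<le>count a N. \<Sum>b | b \<subseteq># filter_mset (\<lambda>x. x \<noteq> N) a. F (b + replicate_mset i N))"
    by (rule sum.cartesian_product[symmetric])
  finally show ?thesis .
qed

text \<open>The exponent of \<open>N\<close> is shared between the two factors: \<open>i\<close>
  copies come from the complete function, whose degree drops to \<open>k - i\<close>, and the others
  from the Schur function, where \<open>sch_branching\<close> removes a strip of that size.\<close>

lemma pieri_step:
  assumes N: "\<And>b. b \<in># a \<Longrightarrow> b < Suc N" and m: "m \<in> pars" and M: "psize m + k \<le> M"
  defines "a' \<equiv> filter_mset (\<lambda>x. x \<noteq> N) a"
  shows "mseries_mult (sch m) (complete_sym k) a =
    (\<Sum>i\<le>min k (count a N). \<Sum>r\<in>pars_le M.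
       strip (count a N - i) m r * mseries_mult (sch r) (complete_sym (k - i)) a')"
proof -
  let ?c = "count a N"
  have term_eq: "sch m (b + replicate_mset (?c - i) N) *
      complete_sym k (a - (b + replicate_mset (?c - i) N)) =
      (if i \<le> k then \<Sum>r\<in>pars_le M. strip (?c - i) m r * (sch r b * complete_sym (k - i) (a' - b)) else 0)"
    if i: "i \<le> ?c" and b: "b \<subseteq># a'" for i b
  proof -
    define d where "d = b + replicate_mset (?c - i) N"
    have cN: "count b N = 0"
      using mset_subset_eq_count[OF b, of N] by (simp add: a'_def)
    have dset: "set_mset d \<subseteq> {..<Suc N}"
    proof
      fix y assume "y \<in># d"
      then have "y \<in># b \<or> y = N" by (auto simp: d_def split: if_splits)
      then show "y \<in> {..<Suc N}"
      proof
        assume "y \<in># b"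
        then have "y \<in># a'" using b by (rule mset_subset_eqD[rotated])
        then show ?thesis using N[of y] by (simp add: a'_def)
      qed simp
    qed
    have dN: "count d N = ?c - i" by (simp add: d_def cN)
    have dfilter: "filter_mset (\<lambda>x. x \<noteq> N) d = b"
      by (rule multiset_eqI) (simp add: d_def cN)
    have s: "sch m d = (\<Sum>r\<in>pars_le M. strip (?c - i) m r * sch r b)"
      using sch_branching[OF m _ dset, of M] M unfolding dN dfilter by simp
    have "a - d = (a' - b) + replicate_mset i N"
    proof (rule multiset_eqI)
      show "count (a - d) y = count ((a' - b) + replicate_mset i N) y" for y
        using i by (cases "y = N") (simp_all add: d_def a'_def cN)
    qed
    then have sz: "size (a - d) = size (a' - b) + i"
      by (simp only: size_union size_replicate_mset)
    have c: "complete_sym k (a - d) = (if i \<le> k then complete_sym (k - i) (a' - b) else 0)"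
    proof (cases "i \<le> k")
      case True
      then have "size (a' - b) + i = k \<longleftrightarrow> size (a' - b) = k - i" by linarith
      then show ?thesis unfolding complete_sym_def sz using True by simp
    next
      case False
      then show ?thesis unfolding complete_sym_def sz by simp
    qed
    show ?thesis
      unfolding d_def[symmetric] s c
      by (cases "i \<le> k") (simp_all only: sum_distrib_right mult.assoc if_True if_False mult_zero_right)
  qed
  have "mseries_mult (sch m) (complete_sym k) a =
    (\<Sum>i\<le>?c. \<Sum>b | b \<subseteq># a'. sch m (b + replicate_mset i N) * complete_sym k (a - (b + replicate_mset i N)))"
    unfolding mseries_mult_def a'_def by (rule sum_submultiset_split)
  \<comment> \<open>The index is reversed so that \<open>i\<close> counts the copies of
    \<open>N\<close> taken by the complete function.\<close>
  also have "\<dots> = (\<Sum>i\<le>?c. \<Sum>b | b \<subseteq># a'. sch m (b + replicate_mset (?c - i) N) *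
      complete_sym k (a - (b + replicate_mset (?c - i) N)))"
    by (rule sum.reindex_bij_witness[where i = "\<lambda>i. ?c - i" and j = "\<lambda>i. ?c - i"]) simp_all
  also have "\<dots> = (\<Sum>i\<le>?c. \<Sum>b | b \<subseteq># a'. if i \<le> k then
      \<Sum>r\<in>pars_le M. strip (?c - i) m r * (sch r b * complete_sym (k - i) (a' - b)) else 0)"
    by (rule sum.cong[OF refl], rule sum.cong[OF refl], rule term_eq) simp_all
  \<comment> \<open>For \<open>i > k\<close> truncated subtraction would turn \<open>k - i\<close>
    into 0, although the complete factor vanishes there; hence the cutoff at
    \<open>min k ?c\<close>.\<close>
  also have "\<dots> = (\<Sum>i\<le>min k ?c. \<Sum>b | b \<subseteq># a'.
      \<Sum>r\<in>pars_le M. strip (?c - i) m r * (sch r b * complete_sym (k - i) (a' - b)))"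
  proof (rule sum.mono_neutral_cong_right)
    show "\<forall>i\<in>{..?c} - {..min k ?c}. (\<Sum>b | b \<subseteq># a'. if i \<le> k then
      \<Sum>r\<in>pars_le M. strip (?c - i) m r * (sch r b * complete_sym (k - i) (a' - b)) else 0) = 0"
    proof
      fix i assume "i \<in> {..?c} - {..min k ?c}"
      then have "\<not> i \<le> k" by auto
      then show "(\<Sum>b | b \<subseteq># a'. if i \<le> k then
        \<Sum>r\<in>pars_le M. strip (?c - i) m r * (sch r b * complete_sym (k - i) (a' - b)) else 0) = 0"
        by (simp only: if_False sum.neutral_const)
    qed
  qed simp_all
  also have "\<dots> = (\<Sum>i\<le>min k ?c. \<Sum>r\<in>pars_le M.
       strip (?c - i) m r * mseries_mult (sch r) (complete_sym (k - i)) a')"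
    unfolding mseries_mult_def sum_distrib_left by (rule sum.cong[OF refl], rule sum.swap)
  finally show ?thesis .
qed

text \<open>
  Moving the removal of a strip past the addition of strips, one variable \<open>x\<close> at a time, picks up
  the factors \<open>1 / (1 - x y)\<close> of the generating function of the complete symmetric functions.
\<close>

lemma pieri:
  assumes "m \<in> pars" and "psize m + k \<le> M"
  shows "mseries_mult (sch m) (complete_sym k) a = (\<Sum>l\<in>pars_le M. strip k l m * sch l a)"
proof -
  obtain N where "\<forall>b\<in>set_mset a. b < N" 
    using finite_nat_set_iff_bounded[THEN iffD1, OF finite_set_mset] ..
  then have "\<And>b. b \<in># a \<Longrightarrow> b < N" by simp
  then show ?thesis using assms
  proof (induction N arbitrary: a m k)
    case 0
    then have "set_mset a = {}" by auto
    then have a: "a = {#}" by simp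
    have z: "(\<lambda>_. 0) \<in> pars_le M" by (simp add: pars_le_def)
    have "mseries_mult (sch m) (complete_sym k) a = sch m {#} * of_bool (k = 0)"
      by (simp add: mseries_mult_def a complete_sym_def)
    also have "\<dots> = of_bool (m = (\<lambda>_. 0) \<and> k = 0)" using 0 by (simp add: sch_empty)
    also have "\<dots> = strip k (\<lambda>_. 0) m"
      using psize_0_iff[OF "0.prems"(2)] hstrip_refl[OF zero_pars(1)] by (auto simp: strip_def)
    also have "\<dots> = (\<Sum>l\<in>pars_le M. if l = (\<lambda>_. 0) then strip k l m else 0)"
      using z by simp
    also have "\<dots> = (\<Sum>l\<in>pars_le M. strip k l m * sch l a)"
      by (rule sum.cong) (simp_all add: a sch_empty pars_le_def)
    finally show ?case .
  next
    case (Suc N)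
    let ?c = "count a N"
    define a' where "a' = filter_mset (\<lambda>x. x \<noteq> N) a"
    have a': "b < N" if "b \<in># a'" for b
    proof -
      have "b \<in># a" "b \<noteq> N" using that by (simp_all add: a'_def)
      then show ?thesis using Suc.prems(1)[of b] by simp
    qed
    have setm: "set_mset a \<subseteq> {..<Suc N}" using Suc.prems(1) by blast
    \<comment> \<open>The factor \<open>strip (?c - i) m r\<close> is kept in front: where it is
      nonzero, \<open>r\<close> is no larger than \<open>m\<close>, and only this yields the size
      bound that the induction hypothesis demands.\<close>
    have IH: "strip (?c - i) m r * mseries_mult (sch r) (complete_sym (k - i)) a' =
        strip (?c - i) m r * (\<Sum>l\<in>pars_le M. strip (k - i) l r * sch l a')" if "r \<in> pars_le M" for i r
    proof (cases "strip (?c - i) m r = 0")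
      case False
      then have "psize r + (k - i) \<le> M" using Suc.prems(3) by (auto simp: strip_def split: if_splits)
      then show ?thesis using Suc.IH[of a' r "k - i"] a' that by (simp add: pars_le_def)
    qed simp
    have "mseries_mult (sch m) (complete_sym k) a = (\<Sum>i\<le>min k ?c. \<Sum>r\<in>pars_le M.
       strip (?c - i) m r * mseries_mult (sch r) (complete_sym (k - i)) a')"
      unfolding a'_def by (rule pieri_step) (use Suc.prems in auto)
    also have "\<dots> = (\<Sum>i\<le>min k ?c. \<Sum>r\<in>pars_le M.
       strip (?c - i) m r * (\<Sum>l\<in>pars_le M. strip (k - i) l r * sch l a'))"
      by (rule sum.cong[OF refl], rule sum.cong[OF refl], rule IH)
    also have "\<dots> = (\<Sum>i\<le>min k ?c. \<Sum>r\<in>pars_le M. \<Sum>l\<in>pars_le M.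
       (strip (?c - i) m r * strip (k - i) l r) * sch l a')"
      by (simp only: sum_distrib_left mult.assoc)
    also have "\<dots> = (\<Sum>i\<le>min k ?c. \<Sum>l\<in>pars_le M. \<Sum>r\<in>pars_le M.
       (strip (?c - i) m r * strip (k - i) l r) * sch l a')"
      by (rule sum.cong[OF refl], rule sum.swap)
    also have "\<dots> = (\<Sum>l\<in>pars_le M. \<Sum>i\<le>min k ?c. \<Sum>r\<in>pars_le M.
       (strip (?c - i) m r * strip (k - i) l r) * sch l a')"
      by (rule sum.swap)
    \<comment> \<open>\<open>strip_down_up\<close>, read from right to left, replaces removing and
      then adding a strip by adding and then removing one. The removed strip is afterwards
      reabsorbed by \<open>sch_branching\<close>.\<close>
    also have "\<dots> = (\<Sum>l\<in>pars_le M. (\<Sum>q\<in>pars_le M. strip k q m * strip ?c q l) * sch l a')"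
    proof (rule sum.cong[OF refl])
      fix l assume "l \<in> pars_le M"
      then have l: "l \<in> pars" "psize l \<le> M" by (simp_all add: pars_le_def)
      show "(\<Sum>i\<le>min k ?c. \<Sum>r\<in>pars_le M. (strip (?c - i) m r * strip (k - i) l r) * sch l a') =
        (\<Sum>q\<in>pars_le M. strip k q m * strip ?c q l) * sch l a'"
        unfolding strip_down_up[OF Suc.prems(2) l(1) Suc.prems(3) l(2)] by (simp only: sum_distrib_right)
    qed
    also have "\<dots> = (\<Sum>l\<in>pars_le M. \<Sum>q\<in>pars_le M. strip k q m * (strip ?c q l * sch l a'))"
      by (simp only: sum_distrib_right mult.assoc)
    also have "\<dots> = (\<Sum>q\<in>pars_le M. \<Sum>l\<in>pars_le M. strip k q m * (strip ?c q l * sch l a'))"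
      by (rule sum.swap)
    also have "\<dots> = (\<Sum>q\<in>pars_le M. strip k q m * sch q a)"
    proof (rule sum.cong[OF refl])
      fix q assume "q \<in> pars_le M"
      then have q: "q \<in> pars" "psize q \<le> M" by (simp_all add: pars_le_def)
      show "(\<Sum>l\<in>pars_le M. strip k q m * (strip ?c q l * sch l a')) = strip k q m * sch q a"
        unfolding sch_branching[OF q setm] a'_def by (simp only: sum_distrib_left)
    qed
    finally show ?case .
  qed
qed

section \<open>Chains of horizontal strips\<close>

lemma mem_pars_le: "p \<in> pars_le M \<longleftrightarrow> p \<in> pars \<and> psize p \<le> M"
  by (simp add: pars_le_def)

text \<open>A skew Kostka number of \<open>l / m\<close>: chains of horizontal strips from
  \<open>m\<close> up to \<open>l\<close>, the head of the list being the size of the outermost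
  strip.\<close>

primrec chain_count :: "(nat \<Rightarrow> nat) \<Rightarrow> nat list \<Rightarrow> (nat \<Rightarrow> nat) \<Rightarrow> int" where
  "chain_count m [] l = of_bool (l = m)"
| "chain_count m (k # ks) l = (\<Sum>r\<in>pars_le (psize l). strip k l r * chain_count m ks r)"

lemma chain_count_degree: "chain_count m ks l \<noteq> 0 \<Longrightarrow> psize l = psize m + sum_list ks"
proof (induction ks arbitrary: l)
  case (Cons k ks)
  then obtain r where "strip k l r * chain_count m ks r \<noteq> 0"
    by (auto elim: sum.not_neutral_contains_not_neutral)
  then have "psize l = psize r + k" "psize r = psize m + sum_list ks"
    using Cons.IH[of r] by (simp_all add: strip_def split: if_splits)
  then show ?case by simp
qed (simp split: if_splits)

text \<open>The recursion sums over a set that depends on \<open>l\<close>. A common bound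
  \<open>M\<close> is needed in order to interchange sums.\<close>

lemma chain_count_Cons:
  assumes "psize l \<le> M"
  shows "chain_count m (k # ks) l = (\<Sum>r\<in>pars_le M. strip k l r * chain_count m ks r)"
  unfolding chain_count.simps
proof (rule sum.mono_neutral_left)
  show "pars_le (psize l) \<subseteq> pars_le M" using assms by (auto simp: pars_le_def)
  show "\<forall>r\<in>pars_le M - pars_le (psize l). strip k l r * chain_count m ks r = 0"
    by (auto simp: pars_le_def strip_def)
qed simp

text \<open>A chain is cut at the partition \<open>r\<close> reached after the inner strips
  \<open>js\<close>. For chains from the empty partition this becomes the separation of two sets of
  variables.\<close>

lemma chain_count_append:
  assumes "m \<in> pars" "l \<in> pars" "psize l \<le> M"
  shows "chain_count m (ks @ js) l = (\<Sum>r\<in>pars_le M. chain_count m js r * chain_count r ks l)"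
  using assms(2,3)
proof (induction ks arbitrary: l)
  case Nil
  have "(\<Sum>r\<in>pars_le M. chain_count m js r * chain_count r [] l) = (\<Sum>r\<in>pars_le M. if l = r then chain_count m js r else 0)"
    by (rule sum.cong) simp_all
  also have "\<dots> = chain_count m js l" using Nil by (simp add: mem_pars_le)
  finally show ?case by simp
next
  case (Cons k ks)
  have "chain_count m ((k # ks) @ js) l = (\<Sum>q\<in>pars_le M. strip k l q * chain_count m (ks @ js) q)"
    unfolding append_Cons by (rule chain_count_Cons[OF Cons.prems(2)])
  also have "\<dots> = (\<Sum>q\<in>pars_le M. strip k l q * (\<Sum>r\<in>pars_le M. chain_count m js r * chain_count r ks q))"
    by (rule sum.cong[OF refl]) (simp add: Cons.IH mem_pars_le)
  also have "\<dots> = (\<Sum>q\<in>pars_le M. \<Sum>r\<in>pars_le M. chain_count m js r * (strip k l q * chain_count r ks q))"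
    by (simp only: sum_distrib_left mult.left_commute)
  also have "\<dots> = (\<Sum>r\<in>pars_le M. \<Sum>q\<in>pars_le M. chain_count m js r * (strip k l q * chain_count r ks q))"
    by (rule sum.swap)
  also have "\<dots> = (\<Sum>r\<in>pars_le M. chain_count m js r * chain_count r (k # ks) l)"
    unfolding chain_count_Cons[OF Cons.prems(2)] by (simp only: sum_distrib_left)
  finally show ?case .
qed

lemma chain_count_swap:
  assumes "m \<in> pars" "l \<in> pars"
  shows "chain_count m (a # b # ks) l = chain_count m (b # a # ks) l"
proof -
  let ?M = "psize l"
  have e: "chain_count m (a # b # ks) l = (\<Sum>r\<in>pars_le ?M. (\<Sum>q\<in>pars_le ?M. strip b q r * strip a l q) * chain_count m ks r)" for a b
  proof -
    have "chain_count m (a # b # ks) l = (\<Sum>q\<in>pars_le ?M. strip a l q * chain_count m (b # ks) q)"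
      by (rule chain_count_Cons) simp
    also have "\<dots> = (\<Sum>q\<in>pars_le ?M. strip a l q * (\<Sum>r\<in>pars_le ?M. strip b q r * chain_count m ks r))"
    proof (rule sum.cong[OF refl])
      fix q assume "q \<in> pars_le ?M"
      then have "psize q \<le> ?M" by (simp add: pars_le_def)
      then show "strip a l q * chain_count m (b # ks) q = strip a l q * (\<Sum>r\<in>pars_le ?M. strip b q r * chain_count m ks r)"
        by (simp only: chain_count_Cons)
    qed
    also have "\<dots> = (\<Sum>q\<in>pars_le ?M. \<Sum>r\<in>pars_le ?M. strip b q r * strip a l q * chain_count m ks r)"
      by (simp only: sum_distrib_left mult.assoc mult.left_commute)
    also have "\<dots> = (\<Sum>r\<in>pars_le ?M. \<Sum>q\<in>pars_le ?M. strip b q r * strip a l q * chain_count m ks r)"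
      by (rule sum.swap)
    also have "\<dots> = (\<Sum>r\<in>pars_le ?M. (\<Sum>q\<in>pars_le ?M. strip b q r * strip a l q) * chain_count m ks r)"
      by (simp only: sum_distrib_right)
    finally show ?thesis .
  qed
  have "(\<Sum>r\<in>pars_le ?M. (\<Sum>q\<in>pars_le ?M. strip b q r * strip a l q) * chain_count m ks r) =
    (\<Sum>r\<in>pars_le ?M. (\<Sum>q\<in>pars_le ?M. strip a q r * strip b l q) * chain_count m ks r)"
  proof (rule sum.cong[OF refl])
    fix r assume "r \<in> pars_le ?M"
    then have "r \<in> pars" by (simp add: pars_le_def)
    then show "(\<Sum>q\<in>pars_le ?M. strip b q r * strip a l q) * chain_count m ks r =
      (\<Sum>q\<in>pars_le ?M. strip a q r * strip b l q) * chain_count m ks r"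
      using strip_commute[OF _ assms(2) order_refl, of r b a] by simp
  qed
  then show ?thesis unfolding e[of a b] e[of b a] .
qed

lemma chain_count_Cons_cong:
  assumes "l \<in> pars" "\<And>r. r \<in> pars \<Longrightarrow> chain_count m ks r = chain_count m js r"
  shows "chain_count m (k # ks) l = chain_count m (k # js) l"
  unfolding chain_count.simps by (rule sum.cong) (simp_all add: assms(2) pars_le_def)

lemma chain_count_move:
  assumes "m \<in> pars" "l \<in> pars"
  shows "chain_count m (ks @ k # js) l = chain_count m (k # ks @ js) l"
  using assms(2)
proof (induction ks arbitrary: l)
  case (Cons a ks)
  have "chain_count m ((a # ks) @ k # js) l = chain_count m (a # k # ks @ js) l"
    unfolding append_Cons by (rule chain_count_Cons_cong[OF Cons.prems Cons.IH])
  also have "\<dots> = chain_count m (k # (a # ks) @ js) l"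
    unfolding append_Cons by (rule chain_count_swap[OF assms(1) Cons.prems])
  finally show ?case .
qed simp

text \<open>Complete symmetric functions commute; on chains this rests on
  \<open>strip_commute\<close>, applied to adjacent strips.\<close>

lemma chain_count_perm:
  assumes "m \<in> pars" "l \<in> pars" "mset ks = mset js"
  shows "chain_count m ks l = chain_count m js l"
  using assms(2,3)
proof (induction ks arbitrary: js l)
  case (Cons k ks)
  then have "k \<in> set js" by (metis list.set_intros(1) mset_eq_setD)
  then obtain as bs where js: "js = as @ k # bs" by (meson split_list)
  have "mset ks = mset (as @ bs)" using Cons.prems(2) by (simp add: js)
  then have "chain_count m (k # ks) l = chain_count m (k # as @ bs) l"
    by (intro chain_count_Cons_cong[OF Cons.prems(1)] Cons.IH)
  also have "\<dots> = chain_count m js l" unfolding js by (rule chain_count_move[OF assms(1) Cons.prems(1), symmetric])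
  finally show ?case .
qed simp

lemma chain_count_zero:
  assumes "l \<in> pars"
  shows "chain_count m (0 # ks) l = chain_count m ks l"
proof -
  have "chain_count m (0 # ks) l = (\<Sum>r\<in>pars_le (psize l). if l = r then chain_count m ks r else 0)"
    unfolding chain_count.simps strip_0[OF assms] by (rule sum.cong) simp_all
  also have "\<dots> = chain_count m ks l" using assms by (simp add: mem_pars_le)
  finally show ?thesis .
qed

lemma chain_count_filter:
  assumes "l \<in> pars"
  shows "chain_count m (filter (\<lambda>k. k \<noteq> 0) ks) l = chain_count m ks l"
  using assms
proof (induction ks arbitrary: l)
  case (Cons k ks)
  show ?case
  proof (cases "k = 0")
    case True
    then show ?thesis using Cons.IH[OF Cons.prems] chain_count_zero[OF Cons.prems, of m ks]
      by (simp del: chain_count.simps)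
  next
    case False
    then have "filter (\<lambda>k. k \<noteq> 0) (k # ks) = k # filter (\<lambda>k. k \<noteq> 0) ks" by simp
    then show ?thesis using chain_count_Cons_cong[OF Cons.prems Cons.IH, of k] by (simp only:)
  qed
qed simp

lemma chain_count_cong:
  assumes m: "m \<in> pars" and l: "l \<in> pars"
    and eq: "filter_mset (\<lambda>k. k \<noteq> 0) (mset ks) = filter_mset (\<lambda>k. k \<noteq> 0) (mset js)"
  shows "chain_count m ks l = chain_count m js l"
proof -
  have "chain_count m (filter (\<lambda>k. k \<noteq> 0) ks) l = chain_count m (filter (\<lambda>k. k \<noteq> 0) js) l"
    by (rule chain_count_perm[OF m l]) (use eq in simp)
  then show ?thesis by (simp only: chain_count_filter[OF l])
qed

section \<open>Dependence on the multiset of exponents\<close>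

definition exps :: "nat multiset \<Rightarrow> nat multiset" where
  "exps a = image_mset (count a) (mset_set (set_mset a))"

text \<open>Sorting merely fixes one canonical order, so that equal exponent multisets give equal
  lists.\<close>

definition exp_list :: "nat multiset \<Rightarrow> nat list" where
  "exp_list a = sorted_list_of_multiset (exps a)"

lemma mset_exp_list [simp]: "mset (exp_list a) = exps a"
  by (simp add: exp_list_def)

lemma zero_notin_exps [simp]: "0 \<notin># exps a"
  by (auto simp: exps_def count_eq_zero_iff)

lemma filter_exps: "filter_mset (\<lambda>k. k \<noteq> 0) (exps a) = exps a"
proof (rule multiset_eqI)
  show "count (filter_mset (\<lambda>k. k \<noteq> 0) (exps a)) x = count (exps a) x" for x
    using zero_notin_exps[of a] by (cases "x = 0") (simp_all add: not_in_iff del: zero_notin_exps)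
qed

lemma sum_mset_exps [simp]: "sum_mset (exps a) = size a"
  by (simp add: exps_def size_multiset_overloaded_eq sum_unfold_sum_mset)

lemma sum_list_exp_list [simp]: "sum_list (exp_list a) = size a"
  by (simp flip: sum_mset_sum_list)

lemma size_exps: "size (exps a) = card (set_mset a)"
  by (simp add: exps_def)

text \<open>By iterating \<open>sch_branching\<close>, a tableau is the chain of shapes formed by
  its entries below 1, 2, and so on. The largest variable gives the outermost strip, hence
  \<open>rev\<close>; variables missing from \<open>a\<close> give empty strips.\<close>

lemma sch_eq_chain_count_upt:
  assumes "l \<in> pars" "\<And>b. b \<in># a \<Longrightarrow> b < N"
  shows "sch l a = chain_count (\<lambda>_. 0) (map (count a) (rev [0..<N])) l"
  using assms
proof (induction N arbitrary: a l)
  case 0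
  then have "set_mset a = {}" by auto
  then have "a = {#}" by simp
  then show ?case using 0(1) by (simp add: sch_empty)
next
  case (Suc N)
  define a' where "a' = filter_mset (\<lambda>x. x \<noteq> N) a"
  have a': "b < N" if "b \<in># a'" for b
  proof -
    have "b \<in># a" "b \<noteq> N" using that by (simp_all add: a'_def)
    then show ?thesis using Suc.prems(2)[of b] by simp
  qed
  have setm: "set_mset a \<subseteq> {..<Suc N}" using Suc.prems(2) by blast
  have e: "map (count a') (rev [0..<N]) = map (count a) (rev [0..<N])"
    by (rule map_cong) (auto simp: a'_def)
  have IH: "sch r a' = chain_count (\<lambda>_. 0) (map (count a) (rev [0..<N])) r" if "r \<in> pars" for r
    using Suc.IH[OF that, of a'] a' unfolding e by blast
  have "sch l a = (\<Sum>r\<in>pars_le (psize l). strip (count a N) l r * sch r a')"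
    unfolding a'_def by (rule sch_branching[OF Suc.prems(1) order_refl setm])
  also have "\<dots> = (\<Sum>r\<in>pars_le (psize l). strip (count a N) l r * chain_count (\<lambda>_. 0) (map (count a) (rev [0..<N])) r)"
    by (rule sum.cong) (simp_all add: IH pars_le_def)
  also have "\<dots> = chain_count (\<lambda>_. 0) (map (count a) (rev [0..<Suc N])) l"
    by simp
  finally show ?case .
qed

text \<open>This contains the symmetry of Schur functions: a coefficient depends only on the
  exponents, not on which variables carry them.\<close>

lemma sch_eq_chain_count:
  assumes "l \<in> pars"
  shows "sch l a = chain_count (\<lambda>_. 0) (exp_list a) l"
proof -
  obtain N where N: "\<forall>b\<in>set_mset a. b < N"
    using finite_nat_set_iff_bounded[THEN iffD1, OF finite_set_mset] ..
  have s: "set_mset a = {i \<in> {0..<N}. count a i \<noteq> 0}" using N by (auto simp: count_eq_zero_iff)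
  have "filter_mset (\<lambda>k. k \<noteq> 0) (mset (map (count a) (rev [0..<N]))) =
      image_mset (count a) (filter_mset (\<lambda>i. count a i \<noteq> 0) (mset_set {0..<N}))"
    by (simp add: filter_mset_image_mset o_def)
  also have "filter_mset (\<lambda>i. count a i \<noteq> 0) (mset_set {0..<N}) = mset_set (set_mset a)"
    unfolding s by (rule filter_mset_mset_set) simp
  also have "image_mset (count a) (mset_set (set_mset a)) = filter_mset (\<lambda>k. k \<noteq> 0) (mset (exp_list a))"
    by (simp only: exps_def[symmetric] filter_exps mset_exp_list)
  finally have "chain_count (\<lambda>_. 0) (map (count a) (rev [0..<N])) l = chain_count (\<lambda>_. 0) (exp_list a) l"
    by (rule chain_count_cong[OF zero_pars(1) assms])
  then show ?thesis using sch_eq_chain_count_upt[OF assms, of a N] N by simp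
qed

section \<open>Products of complete symmetric functions\<close>

primrec complete_prod :: "nat list \<Rightarrow> mseries" where
  "complete_prod [] = mseries_one"
| "complete_prod (k # ks) = mseries_mult (complete_prod ks) (complete_sym k)"

lemma pieri_iterated:
  assumes "m \<in> pars" "psize m + sum_list ks \<le> M"
  shows "mseries_mult (sch m) (complete_prod ks) = (\<lambda>a. \<Sum>l\<in>pars_le M. chain_count m ks l * sch l a)"
  using assms(2)
proof (induction ks)
  case Nil
  have "(\<Sum>l\<in>pars_le M. chain_count m [] l * sch l a) = sch m a" for a
  proof -
    have "(\<Sum>l\<in>pars_le M. chain_count m [] l * sch l a) = (\<Sum>l\<in>pars_le M. if l = m then sch l a else 0)"
      by (rule sum.cong) simp_all
    also have "\<dots> = sch m a" using Nil assms(1) by (simp add: mem_pars_le)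
    finally show ?thesis .
  qed
  then show ?case by (simp add: mseries_mult_one_right)
next
  case (Cons k ks)
  have "mseries_mult (sch m) (complete_prod (k # ks)) =
      mseries_mult (mseries_mult (sch m) (complete_prod ks)) (complete_sym k)"
    by (simp add: mseries_mult_assoc)
  also have "\<dots> = (\<lambda>a. \<Sum>l\<in>pars_le M. chain_count m ks l * mseries_mult (sch l) (complete_sym k) a)"
    using Cons by (simp add: mseries_mult_sum_left)
  also have "\<dots> = (\<lambda>a. \<Sum>l\<in>pars_le M. chain_count m (k # ks) l * sch l a)"
  proof
    fix a
    have "(\<Sum>l\<in>pars_le M. chain_count m ks l * mseries_mult (sch l) (complete_sym k) a) =
      (\<Sum>l\<in>pars_le M. chain_count m ks l * (\<Sum>q\<in>pars_le M. strip k q l * sch q a))"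
    proof (rule sum.cong[OF refl])
      fix l assume l: "l \<in> pars_le M"
      show "chain_count m ks l * mseries_mult (sch l) (complete_sym k) a =
        chain_count m ks l * (\<Sum>q\<in>pars_le M. strip k q l * sch q a)"
      proof (cases "chain_count m ks l = 0")
        case False
        then have "psize l + k \<le> M" using chain_count_degree[OF False] Cons.prems by simp
        then show ?thesis using pieri[of l k M a] l by (simp add: pars_le_def)
      qed simp
    qed
    also have "\<dots> = (\<Sum>l\<in>pars_le M. \<Sum>q\<in>pars_le M. strip k q l * chain_count m ks l * sch q a)"
      by (simp only: sum_distrib_left mult.assoc mult.left_commute)
    also have "\<dots> = (\<Sum>q\<in>pars_le M. \<Sum>l\<in>pars_le M. strip k q l * chain_count m ks l * sch q a)"
      by (rule sum.swap)
    also have "\<dots> = (\<Sum>q\<in>pars_le M. chain_count m (k # ks) q * sch q a)"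
    proof (rule sum.cong[OF refl])
      fix q assume "q \<in> pars_le M"
      then have "psize q \<le> M" by (simp add: pars_le_def)
      then show "(\<Sum>l\<in>pars_le M. strip k q l * chain_count m ks l * sch q a) = chain_count m (k # ks) q * sch q a"
        by (simp only: chain_count_Cons sum_distrib_right)
    qed
    finally show "(\<Sum>l\<in>pars_le M. chain_count m ks l * mseries_mult (sch l) (complete_sym k) a) =
      (\<Sum>q\<in>pars_le M. chain_count m (k # ks) q * sch q a)" .
  qed
  finally show ?case .
qed

lemma sch_zero_eq_one: "sch (\<lambda>_. 0) = mseries_one"
proof
  fix a :: "nat multiset"
  show "sch (\<lambda>_. 0) a = mseries_one a"
    using sch_degree[OF zero_pars(1), of a] by (cases "a = {#}") (auto simp: sch_empty mseries_one_def)
qed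

lemma complete_prod_expansion:
  assumes "sum_list ks \<le> M"
  shows "complete_prod ks = (\<lambda>a. \<Sum>l\<in>pars_le M. chain_count (\<lambda>_. 0) ks l * sch l a)"
  using pieri_iterated[OF zero_pars(1), of ks M] assms
  by (simp add: sch_zero_eq_one mseries_mult_one_left)

section \<open>Littlewood-Richardson coefficients\<close>

lemma triangular_solve:
  fixes M :: "'a \<Rightarrow> 'a \<Rightarrow> int" and r :: "'a \<Rightarrow> int"
  assumes "finite S"
    and "\<And>x. x \<in> S \<Longrightarrow> M x x = 1"
    and "\<And>x y. x \<in> S \<Longrightarrow> y \<in> S \<Longrightarrow> M x y \<noteq> 0 \<Longrightarrow> x = y \<or> r x < r y"
  shows "\<exists>l. \<forall>x\<in>S. (\<Sum>y\<in>S. M x y * l y) = b x"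
  using assms
proof (induction S rule: finite_ranking_induct[where f = "\<lambda>x. - r x"])
  case (insert x S)
  show ?case
  proof (cases "x \<in> S")
    case True
    then have e: "insert x S = S" by (rule insert_absorb)
    show ?thesis unfolding e by (rule insert.IH) (use insert.prems in blast)+
  next
    case False
    obtain l where l: "\<forall>y\<in>S. (\<Sum>z\<in>S. M y z * l z) = b y"
      using insert.IH insert.prems by blast
    \<comment> \<open>The new element \<open>x\<close> has the smallest rank so far, so
      \<open>M y x = 0\<close> for every old row \<open>y\<close>. The old equations keep their
      solution, and the unit diagonal solves the new one without division.\<close>
    define l' where "l' = l(x := b x - (\<Sum>z\<in>S. M x z * l z))"
    have l'S: "(\<Sum>z\<in>S. M y z * l' z) = (\<Sum>z\<in>S. M y z * l z)" for y
      by (rule sum.cong) (use False in \<open>auto simp: l'_def\<close>)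
    have "(\<Sum>z\<in>insert x S. M y z * l' z) = b y" if "y \<in> insert x S" for y
    proof (cases "y = x")
      case True
      then show ?thesis using insert.prems(1)[of x] insert.hyps(1) False
        by (simp add: l'S) (simp add: l'_def)
    next
      case y: False
      then have "y \<in> S" using that by simp
      then have "M y x = 0" using insert.prems(2)[of y x] insert.hyps(2)[of y] y by fastforce
      then show ?thesis using l \<open>y \<in> S\<close> insert.hyps(1) False by (simp add: l'S)
    qed
    then show ?thesis by blast
  qed
qed simp

lemma sum_of_bool_right: "finite S \<Longrightarrow> q \<in> S \<Longrightarrow> (\<Sum>x\<in>S. f x * of_bool (x = q)) = (f q :: int)"
  by (simp add: of_bool_def if_distrib[of "\<lambda>t. _ * t"] cong: if_cong)

lemma sum_of_bool_left: "finite S \<Longrightarrow> q \<in> S \<Longrightarrow> (\<Sum>x\<in>S. of_bool (q = x) * f x) = (f q :: int)"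
  by (simp add: of_bool_def if_distrib[of "\<lambda>t. t * _"] cong: if_cong)

text \<open>Solving for unit vectors gives a right inverse; the transposed matrix is triangular for
  the negated rank and gives a left inverse. Associativity identifies the two.\<close>

lemma triangular_inverse:
  fixes M :: "'a \<Rightarrow> 'a \<Rightarrow> int" and r :: "'a \<Rightarrow> int"
  assumes S: "finite S"
    and diag1: "\<And>x. x \<in> S \<Longrightarrow> M x x = 1"
    and tri: "\<And>x y. x \<in> S \<Longrightarrow> y \<in> S \<Longrightarrow> M x y \<noteq> 0 \<Longrightarrow> x = y \<or> r x < r y"
  shows "\<exists>L. (\<forall>p\<in>S. \<forall>q\<in>S. (\<Sum>x\<in>S. M p x * L x q) = of_bool (p = q)) \<and>
             (\<forall>p\<in>S. \<forall>q\<in>S. (\<Sum>x\<in>S. L p x * M x q) = of_bool (p = q))"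
proof -
  have "\<forall>q. \<exists>l. \<forall>p\<in>S. (\<Sum>x\<in>S. M p x * l x) = of_bool (p = q)"
  proof
    fix q
    show "\<exists>l. \<forall>p\<in>S. (\<Sum>x\<in>S. M p x * l x) = of_bool (p = q)"
      by (rule triangular_solve[of S M r]) (rule S diag1 tri; assumption)+
  qed
  then obtain R where R: "\<And>p q. p \<in> S \<Longrightarrow> (\<Sum>x\<in>S. M p x * R q x) = of_bool (p = q)"
    by metis
  have "\<forall>p. \<exists>l. \<forall>q\<in>S. (\<Sum>x\<in>S. M x q * l x) = of_bool (p = q)"
  proof
    fix p
    show "\<exists>l. \<forall>q\<in>S. (\<Sum>x\<in>S. M x q * l x) = of_bool (p = q)"
    proof (rule triangular_solve[of S "\<lambda>x y. M y x" "\<lambda>x. - r x"])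
      show "x = y \<or> - r x < - r y" if "x \<in> S" "y \<in> S" "M y x \<noteq> 0" for x y
        using tri[OF that(2,1,3)] by auto
    qed (simp_all add: S diag1)
  qed
  then obtain L where L': "\<And>p q. q \<in> S \<Longrightarrow> (\<Sum>x\<in>S. M x q * L p x) = of_bool (p = q)"
    by metis
  have L: "(\<Sum>x\<in>S. L p x * M x q) = of_bool (p = q)" if "q \<in> S" for p q
    using L'[OF that, of p] by (simp only: mult.commute)
  have LR: "L p q = R q p" if p: "p \<in> S" and q: "q \<in> S" for p q
  proof -
    have "L p q = (\<Sum>x\<in>S. L p x * of_bool (x = q))"
      using S q by (simp only: sum_of_bool_right)
    also have "\<dots> = (\<Sum>x\<in>S. L p x * (\<Sum>y\<in>S. M x y * R q y))"
      by (rule sum.cong) (simp_all only: R)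
    also have "\<dots> = (\<Sum>x\<in>S. \<Sum>y\<in>S. L p x * M x y * R q y)"
      by (simp only: sum_distrib_left mult.assoc)
    also have "\<dots> = (\<Sum>y\<in>S. \<Sum>x\<in>S. L p x * M x y * R q y)"
      by (rule sum.swap)
    also have "\<dots> = (\<Sum>y\<in>S. of_bool (p = y) * R q y)"
      by (rule sum.cong) (simp_all only: sum_distrib_right[symmetric] L)
    also have "\<dots> = R q p" using S p by (simp only: sum_of_bool_left)
    finally show ?thesis .
  qed
  have "(\<Sum>x\<in>S. M p x * L x q) = of_bool (p = q)" if "p \<in> S" "q \<in> S" for p q
  proof -
    have "(\<Sum>x\<in>S. M p x * L x q) = (\<Sum>x\<in>S. M p x * R q x)"
      by (rule sum.cong) (simp_all only: LR that(2))
    then show ?thesis using R that by simp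
  qed
  with L show ?thesis by blast
qed

text \<open>From \<open>M K = K A\<close> follows \<open>M = K A L\<close>, and cyclicity of the
  trace brings \<open>L\<close> next to \<open>K\<close>.\<close>

lemma trace_conjugate:
  fixes M A K L :: "'a \<Rightarrow> 'a \<Rightarrow> int"
  assumes S: "finite S"
    and KL: "\<And>p q. p \<in> S \<Longrightarrow> q \<in> S \<Longrightarrow> (\<Sum>x\<in>S. K p x * L x q) = of_bool (p = q)"
    and LK: "\<And>p q. p \<in> S \<Longrightarrow> q \<in> S \<Longrightarrow> (\<Sum>x\<in>S. L p x * K x q) = of_bool (p = q)"
    and MK: "\<And>p q. p \<in> S \<Longrightarrow> q \<in> S \<Longrightarrow> (\<Sum>x\<in>S. M p x * K x q) = (\<Sum>x\<in>S. K p x * A x q)"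
  shows "(\<Sum>p\<in>S. M p p) = (\<Sum>p\<in>S. A p p)"
proof -
  have "M p p = (\<Sum>q\<in>S. \<Sum>x\<in>S. L q p * K p x * A x q)" if p: "p \<in> S" for p
  proof -
    have "M p p = (\<Sum>x\<in>S. M p x * of_bool (x = p))"
      using S p by (simp only: sum_of_bool_right)
    also have "\<dots> = (\<Sum>x\<in>S. M p x * (\<Sum>q\<in>S. K x q * L q p))"
      by (rule sum.cong) (simp_all only: KL p)
    also have "\<dots> = (\<Sum>x\<in>S. \<Sum>q\<in>S. M p x * K x q * L q p)"
      by (simp only: sum_distrib_left mult.assoc)
    also have "\<dots> = (\<Sum>q\<in>S. \<Sum>x\<in>S. M p x * K x q * L q p)"
      by (rule sum.swap)
    also have "\<dots> = (\<Sum>q\<in>S. (\<Sum>x\<in>S. K p x * A x q) * L q p)"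
      by (rule sum.cong) (simp_all only: sum_distrib_right[symmetric] MK p)
    also have "\<dots> = (\<Sum>q\<in>S. \<Sum>x\<in>S. L q p * K p x * A x q)"
      by (simp only: sum_distrib_right) (simp only: mult_ac)
    finally show ?thesis .
  qed
  then have "(\<Sum>p\<in>S. M p p) = (\<Sum>p\<in>S. \<Sum>q\<in>S. \<Sum>x\<in>S. L q p * K p x * A x q)"
    by (rule sum.cong[OF refl])
  also have "\<dots> = (\<Sum>q\<in>S. \<Sum>p\<in>S. \<Sum>x\<in>S. L q p * K p x * A x q)"
    by (rule sum.swap)
  also have "\<dots> = (\<Sum>q\<in>S. \<Sum>x\<in>S. \<Sum>p\<in>S. L q p * K p x * A x q)"
    by (rule sum.cong[OF refl], rule sum.swap)
  also have "\<dots> = (\<Sum>q\<in>S. \<Sum>x\<in>S. of_bool (q = x) * A x q)"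
  proof (rule sum.cong[OF refl], rule sum.cong[OF refl])
    fix q x assume "q \<in> S" "x \<in> S"
    then show "(\<Sum>p\<in>S. L q p * K p x * A x q) = of_bool (q = x) * A x q"
      unfolding sum_distrib_right[symmetric] by (simp only: LK)
  qed
  also have "\<dots> = (\<Sum>q\<in>S. A q q)"
    by (rule sum.cong) (use S in \<open>simp_all only: sum_of_bool_left\<close>)
  finally show ?thesis .
qed

section \<open>Inverse Kostka matrix and structure constants\<close>

definition kostka_inverse :: "nat \<Rightarrow> (nat \<Rightarrow> nat) \<Rightarrow> (nat \<Rightarrow> nat) \<Rightarrow> int" where
  "kostka_inverse n = (SOME L.
     (\<forall>p\<in>pars_of n. \<forall>q\<in>pars_of n. (\<Sum>x\<in>pars_of n. sch p (shape_mset x) * L x q) = of_bool (p = q)) \<and>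
     (\<forall>p\<in>pars_of n. \<forall>q\<in>pars_of n. (\<Sum>x\<in>pars_of n. L p x * sch x (shape_mset q)) = of_bool (p = q)))"

lemma mem_pars_of: "p \<in> pars_of n \<longleftrightarrow> p \<in> pars \<and> psize p = n"
  by (simp add: pars_of_def)

lemma kostka_inverse:
  "\<forall>p\<in>pars_of n. \<forall>q\<in>pars_of n. (\<Sum>x\<in>pars_of n. sch p (shape_mset x) * kostka_inverse n x q) = of_bool (p = q)"
  "\<forall>p\<in>pars_of n. \<forall>q\<in>pars_of n. (\<Sum>x\<in>pars_of n. kostka_inverse n p x * sch x (shape_mset q)) = of_bool (p = q)"
proof -
  have "\<exists>L. (\<forall>p\<in>pars_of n. \<forall>q\<in>pars_of n. (\<Sum>x\<in>pars_of n. sch p (shape_mset x) * L x q) = of_bool (p = q)) \<and>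
     (\<forall>p\<in>pars_of n. \<forall>q\<in>pars_of n. (\<Sum>x\<in>pars_of n. L p x * sch x (shape_mset q)) = of_bool (p = q))"
  proof (rule triangular_inverse[where r = "\<lambda>p. int (sum_mset (shape_mset p))"])
    show "x = y \<or> int (sum_mset (shape_mset x)) < int (sum_mset (shape_mset y))"
      if "x \<in> pars_of n" "y \<in> pars_of n" "sch x (shape_mset y) \<noteq> 0" for x y
      using sch_triangular[of x y] that unfolding mem_pars_of of_nat_less_iff by blast
  qed (simp_all add: sch_shape_mset_self mem_pars_of)
  from someI_ex[OF this]
  show "\<forall>p\<in>pars_of n. \<forall>q\<in>pars_of n. (\<Sum>x\<in>pars_of n. sch p (shape_mset x) * kostka_inverse n x q) = of_bool (p = q)"
    "\<forall>p\<in>pars_of n. \<forall>q\<in>pars_of n. (\<Sum>x\<in>pars_of n. kostka_inverse n p x * sch x (shape_mset q)) = of_bool (p = q)"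
    unfolding kostka_inverse_def[symmetric] by blast+
qed

text \<open>The inverse Kostka matrix expands \<open>s_n\<close> in products of complete functions,
  and the iterated Pieri rule multiplies each of them by \<open>s_m\<close>; this is the resulting
  coefficient of \<open>s_l\<close>.\<close>

definition lr :: "(nat \<Rightarrow> nat) \<Rightarrow> (nat \<Rightarrow> nat) \<Rightarrow> (nat \<Rightarrow> nat) \<Rightarrow> int" where
  "lr m n l = (\<Sum>q\<in>pars_of (psize n). chain_count m (exp_list (shape_mset q)) l * kostka_inverse (psize n) q n)"

lemma lr_degree:
  assumes "lr m n l \<noteq> 0"
  shows "psize l = psize m + psize n"
proof -
  obtain q where q: "q \<in> pars_of (psize n)"
    "chain_count m (exp_list (shape_mset q)) l * kostka_inverse (psize n) q n \<noteq> 0"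
    using assms unfolding lr_def by (rule sum.not_neutral_contains_not_neutral)
  then have "psize l = psize m + sum_list (exp_list (shape_mset q))"
    by (intro chain_count_degree) simp
  then show ?thesis using q(1) by (simp add: mem_pars_of size_shape_mset)
qed

lemma sch_complete_prod:
  assumes n: "n \<in> pars"
  shows "sch n = (\<lambda>a. \<Sum>q\<in>pars_of (psize n). kostka_inverse (psize n) q n * complete_prod (exp_list (shape_mset q)) a)"
proof
  fix a
  let ?P = "pars_of (psize n)" and ?L = "kostka_inverse (psize n)"
  have nP: "n \<in> ?P" using n by (simp add: mem_pars_of)
  have cp: "complete_prod (exp_list (shape_mset q)) a = (\<Sum>l\<in>?P. sch l (shape_mset q) * sch l a)"
    if q: "q \<in> ?P" for q
  proof -
    have "size (shape_mset q) \<le> psize n" using q by (simp add: mem_pars_of size_shape_mset)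
    then have "complete_prod (exp_list (shape_mset q)) a =
        (\<Sum>l\<in>pars_le (psize n). chain_count (\<lambda>_. 0) (exp_list (shape_mset q)) l * sch l a)"
      using complete_prod_expansion[of "exp_list (shape_mset q)" "psize n"] by simp
    also have "\<dots> = (\<Sum>l\<in>pars_le (psize n). sch l (shape_mset q) * sch l a)"
      by (rule sum.cong) (simp_all add: sch_eq_chain_count[symmetric] mem_pars_le)
    also have "\<dots> = (\<Sum>l\<in>?P. sch l (shape_mset q) * sch l a)"
    proof (rule sum.mono_neutral_right)
      show "?P \<subseteq> pars_le (psize n)" by (rule pars_of_subset) simp
      show "\<forall>l\<in>pars_le (psize n) - ?P. sch l (shape_mset q) * sch l a = 0"
      proof
        fix l assume l: "l \<in> pars_le (psize n) - ?P"
        then have "l \<in> pars" "psize l \<noteq> psize n" by (simp_all add: mem_pars_le mem_pars_of)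
        then have "sch l (shape_mset q) = 0"
          using sch_degree[of l "shape_mset q"] q by (auto simp: size_shape_mset mem_pars_of)
        then show "sch l (shape_mset q) * sch l a = 0" by simp
      qed
    qed simp
    finally show ?thesis .
  qed
  have "(\<Sum>q\<in>?P. ?L q n * complete_prod (exp_list (shape_mset q)) a) =
      (\<Sum>q\<in>?P. ?L q n * (\<Sum>l\<in>?P. sch l (shape_mset q) * sch l a))"
    by (rule sum.cong) (simp_all only: cp)
  also have "\<dots> = (\<Sum>q\<in>?P. \<Sum>l\<in>?P. sch l (shape_mset q) * ?L q n * sch l a)"
    by (simp only: sum_distrib_left mult.assoc mult.left_commute)
  also have "\<dots> = (\<Sum>l\<in>?P. \<Sum>q\<in>?P. sch l (shape_mset q) * ?L q n * sch l a)"
    by (rule sum.swap)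
  also have "\<dots> = (\<Sum>l\<in>?P. of_bool (n = l) * sch l a)"
  proof (rule sum.cong[OF refl])
    fix l assume "l \<in> ?P"
    then show "(\<Sum>q\<in>?P. sch l (shape_mset q) * ?L q n * sch l a) = of_bool (n = l) * sch l a"
      unfolding sum_distrib_right[symmetric] using kostka_inverse(1)[of "psize n"] nP
      by (simp add: eq_commute[of n])
  qed
  also have "\<dots> = sch n a" using nP by (simp only: sum_of_bool_left finite_pars_of)
  finally show "sch n a = (\<Sum>q\<in>?P. ?L q n * complete_prod (exp_list (shape_mset q)) a)" ..
qed

lemma sch_mult_expansion:
  assumes m: "m \<in> pars" and n: "n \<in> pars" and M: "psize m + psize n \<le> M"
  shows "mseries_mult (sch m) (sch n) = (\<lambda>a. \<Sum>l\<in>pars_le M. lr m n l * sch l a)"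
proof
  fix a
  let ?P = "pars_of (psize n)" and ?L = "kostka_inverse (psize n)"
  have "mseries_mult (sch m) (sch n) a =
      (\<Sum>q\<in>?P. ?L q n * mseries_mult (sch m) (complete_prod (exp_list (shape_mset q))) a)"
    by (subst sch_complete_prod[OF n]) (simp only: mseries_mult_sum_right)
  also have "\<dots> = (\<Sum>q\<in>?P. ?L q n * (\<Sum>l\<in>pars_le M. chain_count m (exp_list (shape_mset q)) l * sch l a))"
  proof (rule sum.cong[OF refl])
    fix q assume "q \<in> ?P"
    then have "psize m + sum_list (exp_list (shape_mset q)) \<le> M"
      using M by (simp add: mem_pars_of size_shape_mset)
    then show "?L q n * mseries_mult (sch m) (complete_prod (exp_list (shape_mset q))) a =
      ?L q n * (\<Sum>l\<in>pars_le M. chain_count m (exp_list (shape_mset q)) l * sch l a)"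
      by (simp only: pieri_iterated[OF m])
  qed
  also have "\<dots> = (\<Sum>q\<in>?P. \<Sum>l\<in>pars_le M. chain_count m (exp_list (shape_mset q)) l * ?L q n * sch l a)"
    by (simp only: sum_distrib_left mult.assoc mult.left_commute)
  also have "\<dots> = (\<Sum>l\<in>pars_le M. \<Sum>q\<in>?P. chain_count m (exp_list (shape_mset q)) l * ?L q n * sch l a)"
    by (rule sum.swap)
  also have "\<dots> = (\<Sum>l\<in>pars_le M. lr m n l * sch l a)"
    by (simp only: lr_def sum_distrib_right)
  finally show "mseries_mult (sch m) (sch n) a = (\<Sum>l\<in>pars_le M. lr m n l * sch l a)" .
qed

text \<open>Undoing the Kostka inverse inside \<open>lr\<close> shows that the structure constants
  of the product also expand skew Schur functions: \<open>s_(l/m)\<close> is the sum of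
  \<open>lr m n l\<close> times \<open>s_n\<close>. This takes the place of duality under a scalar
  product.\<close>

lemma chain_count_lr_shape:
  assumes q: "q \<in> pars_of k"
  shows "chain_count m (exp_list (shape_mset q)) l = (\<Sum>n\<in>pars_of k. lr m n l * sch n (shape_mset q))"
proof -
  let ?P = "pars_of k" and ?L = "kostka_inverse k"
  have "(\<Sum>n\<in>?P. lr m n l * sch n (shape_mset q)) =
    (\<Sum>n\<in>?P. (\<Sum>x\<in>?P. chain_count m (exp_list (shape_mset x)) l * ?L x n) * sch n (shape_mset q))"
    by (rule sum.cong) (simp_all add: lr_def mem_pars_of)
  also have "\<dots> = (\<Sum>n\<in>?P. \<Sum>x\<in>?P. chain_count m (exp_list (shape_mset x)) l * (?L x n * sch n (shape_mset q)))"
    by (simp only: sum_distrib_right mult.assoc)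
  also have "\<dots> = (\<Sum>x\<in>?P. \<Sum>n\<in>?P. chain_count m (exp_list (shape_mset x)) l * (?L x n * sch n (shape_mset q)))"
    by (rule sum.swap)
  also have "\<dots> = (\<Sum>x\<in>?P. chain_count m (exp_list (shape_mset x)) l * of_bool (x = q))"
  proof (rule sum.cong[OF refl])
    fix x assume "x \<in> ?P"
    then show "(\<Sum>n\<in>?P. chain_count m (exp_list (shape_mset x)) l * (?L x n * sch n (shape_mset q))) =
      chain_count m (exp_list (shape_mset x)) l * of_bool (x = q)"
      unfolding sum_distrib_left[symmetric] using kostka_inverse(2)[of k] q by simp
  qed
  also have "\<dots> = chain_count m (exp_list (shape_mset q)) l"
    using q by (simp only: sum_of_bool_right finite_pars_of)
  finally show ?thesis ..
qed

section \<open>The doubling operator\<close>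

definition row :: "nat list \<Rightarrow> nat \<Rightarrow> nat" where
  "row l i = (if i < length l then l ! i else 0)"

lemma partitions_nth:
  assumes "l \<in> partitions"
  shows "i < j \<Longrightarrow> j < length l \<Longrightarrow> l ! j \<le> l ! i" "i < length l \<Longrightarrow> 0 < l ! i"
proof -
  show "l ! j \<le> l ! i" if "i < j" "j < length l"
    using assms sorted_wrt_nth_less[of "(\<ge>)" l i j] that by (simp add: partitions_def)
  show "0 < l ! i" if "i < length l"
    using assms nth_mem[OF that] unfolding partitions_def by blast
qed

lemma row_nonzero_iff: "l \<in> partitions \<Longrightarrow> row l i \<noteq> 0 \<longleftrightarrow> i < length l"
  using partitions_nth(2)[of l i] by (cases "i < length l") (simp_all add: row_def)

lemma row_pars: "l \<in> partitions \<Longrightarrow> row l \<in> pars"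
proof (rule parsI)
  assume l: "l \<in> partitions"
  show "row l (Suc i) \<le> row l i" for i
    using partitions_nth(1)[OF l, of i "Suc i"] by (simp add: row_def)
  show "row l i = 0" if "length l \<le> i" for i
    using that by (simp add: row_def)
qed

lemma map_row: "map (row l) [0..<length l] = l"
  by (rule nth_equalityI) (simp_all add: row_def)

lemma psize_row: "psize (row l) = sum_list l"
proof -
  have "psize (row l) = (\<Sum>i<length l. row l i)"
    by (rule psize_eq) (simp add: row_def)
  also have "\<dots> = (\<Sum>i<length l. l ! i)"
    by (rule sum.cong) (simp_all add: row_def)
  also have "\<dots> = sum_list l" by (simp add: sum_list_sum_nth atLeast0LessThan)
  finally show ?thesis .
qed

lemma row_inj: "inj_on row partitions"
proof (rule inj_onI)
  fix l k assume l: "l \<in> partitions" and k: "k \<in> partitions" and eq: "row l = row k"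
  have iff: "i < length l \<longleftrightarrow> i < length k" for i
    using row_nonzero_iff[OF l, of i] row_nonzero_iff[OF k, of i] by (simp only: eq)
  have "length l = length k" using iff[of "length l"] iff[of "length k"] by simp
  then have "map (row l) [0..<length l] = map (row k) [0..<length k]" by (simp only: eq)
  then show "l = k" by (simp only: map_row)
qed

lemma row_surj:
  assumes p: "p \<in> pars"
  obtains l where "l \<in> partitions" "row l = p"
proof -
  define k where "k = (LEAST i. p i = 0)"
  have k0: "p k = 0" unfolding k_def
    by (rule LeastI[of "\<lambda>i. p i = 0" "psize p"]) (rule pars_zero_beyond[OF p order_refl])
  have pos: "0 < p i" if "i < k" for i
    using not_less_Least[OF that[unfolded k_def]] by simp
  have zero: "p i = 0" if "k \<le> i" for i
    using antimono_parsD[OF p that] k0 by simp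
  show ?thesis
  proof (rule that)
    show "map p [0..<k] \<in> partitions"
      using pos antimono_parsD[OF p] by (simp add: partitions_def sorted_wrt_iff_nth_less)
    show "row (map p [0..<k]) = p"
    proof
      show "row (map p [0..<k]) i = p i" for i
        using zero[of i] by (cases "i < k") (simp_all add: row_def)
    qed
  qed
qed

section \<open>Partitions as multisets of parts\<close>

lemma set_shape_mset: "p \<in> pars \<Longrightarrow> set_mset (shape_mset p) = {i. p i \<noteq> 0}"
  by (rule set_eqI) (simp add: count_shape_mset[symmetric] count_eq_zero_iff)

lemma exps_row:
  assumes l: "l \<in> partitions"
  shows "exps (shape_mset (row l)) = mset l"
proof -
  have "count (shape_mset (row l)) = row l"
    by (rule ext) (rule count_shape_mset[OF row_pars[OF l]])
  moreover have "set_mset (shape_mset (row l)) = {0..<length l}"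
    using row_nonzero_iff[OF l] by (simp add: set_shape_mset row_pars l atLeast0LessThan lessThan_def)
  ultimately have "exps (shape_mset (row l)) = image_mset (row l) (mset_set {0..<length l})"
    by (simp only: exps_def)
  also have "\<dots> = mset (map (row l) [0..<length l])" by simp
  finally show ?thesis by (simp only: map_row)
qed

lemma partitions_mset_inj:
  assumes "l \<in> partitions" "k \<in> partitions" "mset l = mset k"
  shows "l = k"
proof -
  have "sorted (rev l)" "sorted (rev k)"
    using assms(1,2) by (simp_all add: partitions_def sorted_wrt_rev)
  moreover have "mset (rev l) = mset (rev k)" using assms(3) by simp
  ultimately have "rev l = rev k" by (metis properties_for_sort)
  then show ?thesis by simp
qed

lemma exps_shape_inj:
  assumes "p \<in> pars" "q \<in> pars" "exps (shape_mset p) = exps (shape_mset q)"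
  shows "p = q"
proof -
  obtain l where l: "l \<in> partitions" "row l = p" using row_surj[OF assms(1)] .
  obtain k where k: "k \<in> partitions" "row k = q" using row_surj[OF assms(2)] .
  have "mset l = mset k" using assms(3) l(2) k(2) exps_row[OF l(1)] exps_row[OF k(1)] by simp
  then show ?thesis using partitions_mset_inj[OF l(1) k(1)] l(2) k(2) by simp
qed

lemma partition_of_mset:
  assumes "0 \<notin># M"
  shows "rev (sorted_list_of_multiset M) \<in> partitions"
proof -
  have "\<forall>x\<in>set (sorted_list_of_multiset M). 0 < x"
    using assms by (metis gr0I set_sorted_list_of_multiset)
  moreover have "sorted_wrt (\<ge>) (rev (sorted_list_of_multiset M))"
    by (simp add: sorted_wrt_rev sorted_sorted_list_of_multiset)
  ultimately show ?thesis by (simp add: partitions_def)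
qed

text \<open>Every multiset of positive numbers is the exponent type of a partition monomial. Hence
  whatever depends on exponents alone can be evaluated at some \<open>shape_mset q\<close>.\<close>

lemma exps_shape_ex:
  assumes "0 \<notin># M"
  obtains q where "q \<in> pars_of (sum_mset M)" "exps (shape_mset q) = M"
proof
  let ?l = "rev (sorted_list_of_multiset M)"
  have l: "?l \<in> partitions" by (rule partition_of_mset[OF assms])
  show e: "exps (shape_mset (row ?l)) = M" by (simp add: exps_row[OF l])
  have "psize (row ?l) = sum_mset M"
    using sum_mset_exps[of "shape_mset (row ?l)"] size_shape_mset[OF row_pars[OF l]] e by simp
  then show "row ?l \<in> pars_of (sum_mset M)" by (simp add: mem_pars_of row_pars l)
qed

section \<open>Coproduct by cutting chains\<close>

lemma chain_count_exps:
  assumes "m \<in> pars" "l \<in> pars" "exps a + exps b = exps c"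
  shows "chain_count m (exp_list a @ exp_list b) l = chain_count m (exp_list c) l"
  by (rule chain_count_cong[OF assms(1,2)]) (simp add: assms(3))

lemma exp_list_cong:
  assumes "exps a = exps b"
  shows "exp_list a = exp_list b"
  using assms by (simp add: exp_list_def)

text \<open>Both sides depend on \<open>c\<close> only through its exponents, so \<open>c\<close>
  may be replaced by a partition monomial, where \<open>chain_count_lr_shape\<close>
  applies.\<close>

lemma chain_count_lr:
  shows "chain_count m (exp_list c) l = (\<Sum>n\<in>pars_of (size c). lr m n l * sch n c)"
proof -
  obtain q where q: "q \<in> pars_of (sum_mset (exps c))" "exps (shape_mset q) = exps c"
    using exps_shape_ex[OF zero_notin_exps, of c] .
  have e: "exp_list (shape_mset q) = exp_list c" by (rule exp_list_cong[OF q(2)])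
  have q': "q \<in> pars_of (size c)" using q(1) by simp
  show ?thesis
    unfolding e[symmetric] chain_count_lr_shape[OF q', of m l]
  proof (rule sum.cong[OF refl])
    fix n assume "n \<in> pars_of (size c)"
    then have "sch n (shape_mset q) = sch n c" by (simp only: sch_eq_chain_count mem_pars_of e)
    then show "lr m n l * sch n (shape_mset q) = lr m n l * sch n c" by (simp only:)
  qed
qed

text \<open>The left side is the coefficient of \<open>x^b y^c\<close> in \<open>s_l(x, y)\<close>.
  Cutting at the partition \<open>m\<close> filled by the strips of \<open>b\<close> gives
  \<open>s_m(x) s_(l/m)(y)\<close>, and the second factor is expanded by
  \<open>chain_count_lr\<close>.\<close>

lemma chain_count_coproduct:
  assumes l: "l \<in> pars_of k" and bc: "size b + size c = k"
  shows "chain_count (\<lambda>_. 0) (exp_list c @ exp_list b) l =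
    (\<Sum>m\<in>pars_le k. \<Sum>n\<in>pars_le k. lr m n l * (sch m b * sch n c))"
proof -
  have "chain_count (\<lambda>_. 0) (exp_list c @ exp_list b) l =
    (\<Sum>m\<in>pars_le k. chain_count (\<lambda>_. 0) (exp_list b) m * chain_count m (exp_list c) l)"
    by (rule chain_count_append) (use l in \<open>simp_all add: mem_pars_of\<close>)
  also have "\<dots> = (\<Sum>m\<in>pars_le k. sch m b * (\<Sum>n\<in>pars_le k. lr m n l * sch n c))"
  proof (rule sum.cong[OF refl])
    fix m assume "m \<in> pars_le k"
    then have m: "m \<in> pars" by (simp add: mem_pars_le)
    have "chain_count m (exp_list c) l = (\<Sum>n\<in>pars_of (size c). lr m n l * sch n c)"
      by (rule chain_count_lr)
    also have "\<dots> = (\<Sum>n\<in>pars_le k. lr m n l * sch n c)"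
    proof (rule sum.mono_neutral_left)
      show "pars_of (size c) \<subseteq> pars_le k" by (rule pars_of_subset) (use bc in simp)
      show "\<forall>n\<in>pars_le k - pars_of (size c). lr m n l * sch n c = 0"
      proof
        fix n assume "n \<in> pars_le k - pars_of (size c)"
        then have "n \<in> pars" "psize n \<noteq> size c" by (simp_all add: mem_pars_le mem_pars_of)
        then show "lr m n l * sch n c = 0" using sch_degree[of n c] by auto
      qed
    qed simp
    finally show "chain_count (\<lambda>_. 0) (exp_list b) m * chain_count m (exp_list c) l =
      sch m b * (\<Sum>n\<in>pars_le k. lr m n l * sch n c)"
      using sch_eq_chain_count[OF m, of b] by simp
  qed
  also have "\<dots> = (\<Sum>m\<in>pars_le k. \<Sum>n\<in>pars_le k. lr m n l * (sch m b * sch n c))"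
    by (simp only: sum_distrib_left mult.left_commute)
  finally show ?thesis .
qed

text \<open>At \<open>a = shape_mset q\<close> this is the coefficient of the complete product of
  \<open>r\<close> in that of \<open>q\<close> after doubling the variables: \<open>h_k\<close>
  becomes the sum of all \<open>h_j h_(k-j)\<close>, and \<open>b\<close> records the
  \<open>j\<close> chosen for each part of \<open>q\<close>.\<close>

definition doubling :: "(nat \<Rightarrow> nat) \<Rightarrow> nat multiset \<Rightarrow> int" where
  "doubling r a = (\<Sum>b | b \<subseteq># a. of_bool (exps (shape_mset r) = exps (a - b) + exps b))"

text \<open>
  Both sides are the coefficient of \<open>x\<^sup>a\<close> in the Schur function of \<open>l\<close> with every variable
  doubled.
\<close>

lemma doubled_schur:
  assumes l: "l \<in> pars_of k" and a: "size a = k"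
  shows "(\<Sum>q\<in>pars_of k. (\<Sum>m\<in>pars_le k. \<Sum>n\<in>pars_le k. lr m n l * lr m n q) * sch q a) =
    (\<Sum>r\<in>pars_of k. sch l (shape_mset r) * doubling r a)"
proof -
  let ?P = "pars_le k"
  have lp: "l \<in> pars" "psize l = k" using l by (simp_all add: mem_pars_of)
  \<comment> \<open>The chain count is the Kostka number at the unique partition with the required
    exponents. Writing it as a sum over all \<open>r\<close> with an indicator allows the sum over
    \<open>b\<close> to be pulled inside.\<close>
  have chain: "chain_count (\<lambda>_. 0) (exp_list (a - b) @ exp_list b) l =
      (\<Sum>r\<in>pars_of k. sch l (shape_mset r) * of_bool (exps (shape_mset r) = exps (a - b) + exps b))"
    if b: "b \<subseteq># a" for b
  proof -
    let ?M = "exps (a - b) + exps b"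
    have "0 \<notin># ?M" by simp
    then obtain q where q: "q \<in> pars_of (sum_mset ?M)" "exps (shape_mset q) = ?M"
      by (rule exps_shape_ex)
    have "sum_mset ?M = size a" using size_mset_mono[OF b] b by (simp add: size_Diff_submset)
    then have qk: "q \<in> pars_of k" using q(1) a by simp
    have "chain_count (\<lambda>_. 0) (exp_list (a - b) @ exp_list b) l = sch l (shape_mset q)"
      unfolding sch_eq_chain_count[OF lp(1)] by (rule chain_count_exps[OF zero_pars(1) lp(1) q(2)[symmetric]])
    also have "\<dots> = (\<Sum>r\<in>pars_of k. sch l (shape_mset r) * of_bool (r = q))"
      using qk by (simp only: sum_of_bool_right finite_pars_of)
    also have "\<dots> = (\<Sum>r\<in>pars_of k. sch l (shape_mset r) * of_bool (exps (shape_mset r) = ?M))"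
    proof (rule sum.cong[OF refl])
      fix r assume "r \<in> pars_of k"
      then have "r = q \<longleftrightarrow> exps (shape_mset r) = ?M"
        using exps_shape_inj[of r q] q(2) qk by (auto simp: mem_pars_of)
      then show "sch l (shape_mset r) * of_bool (r = q) = sch l (shape_mset r) * of_bool (exps (shape_mset r) = ?M)"
        by (simp only:)
    qed
    finally show ?thesis .
  qed
  have "(\<Sum>r\<in>pars_of k. sch l (shape_mset r) * doubling r a) =
    (\<Sum>r\<in>pars_of k. \<Sum>b | b \<subseteq># a. sch l (shape_mset r) * of_bool (exps (shape_mset r) = exps (a - b) + exps b))"
    by (simp only: doubling_def sum_distrib_left)
  also have "\<dots> = (\<Sum>b | b \<subseteq># a. \<Sum>r\<in>pars_of k. sch l (shape_mset r) * of_bool (exps (shape_mset r) = exps (a - b) + exps b))"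
    by (rule sum.swap)
  also have "\<dots> = (\<Sum>b | b \<subseteq># a. \<Sum>m\<in>?P. \<Sum>n\<in>?P. lr m n l * (sch m b * sch n (a - b)))"
  proof (rule sum.cong[OF refl])
    fix b assume "b \<in> {b. b \<subseteq># a}"
    then have b: "b \<subseteq># a" by simp
    have "size b + size (a - b) = k" using size_mset_mono[OF b] b a by (simp add: size_Diff_submset)
    then show "(\<Sum>r\<in>pars_of k. sch l (shape_mset r) * of_bool (exps (shape_mset r) = exps (a - b) + exps b)) =
      (\<Sum>m\<in>?P. \<Sum>n\<in>?P. lr m n l * (sch m b * sch n (a - b)))"
      using chain[OF b] chain_count_coproduct[OF l] by (simp only:)
  qed
  also have "\<dots> = (\<Sum>m\<in>?P. \<Sum>b | b \<subseteq># a. \<Sum>n\<in>?P. lr m n l * (sch m b * sch n (a - b)))"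
    by (rule sum.swap)
  also have "\<dots> = (\<Sum>m\<in>?P. \<Sum>n\<in>?P. \<Sum>b | b \<subseteq># a. lr m n l * (sch m b * sch n (a - b)))"
    by (rule sum.cong[OF refl], rule sum.swap)
  \<comment> \<open>Identifying the two sets of variables turns the sum over \<open>b\<close> into a
    product of Schur functions. Its expansion brings in the coefficients a second time.\<close>
  also have "\<dots> = (\<Sum>m\<in>?P. \<Sum>n\<in>?P. lr m n l * mseries_mult (sch m) (sch n) a)"
    by (simp only: mseries_mult_def sum_distrib_left)
  also have "\<dots> = (\<Sum>m\<in>?P. \<Sum>n\<in>?P. lr m n l * (\<Sum>q\<in>pars_of k. lr m n q * sch q a))"
  proof (rule sum.cong[OF refl], rule sum.cong[OF refl])
    fix m n assume "m \<in> ?P" "n \<in> ?P"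
    then have mn: "m \<in> pars" "n \<in> pars" by (simp_all add: mem_pars_le)
    show "lr m n l * mseries_mult (sch m) (sch n) a = lr m n l * (\<Sum>q\<in>pars_of k. lr m n q * sch q a)"
    proof (cases "lr m n l = 0")
      case False
      \<comment> \<open>A nonzero first factor fixes the degree of the product, so only partitions
        of \<open>k\<close> survive in its expansion.\<close>
      then have s: "psize m + psize n = k" using lr_degree[OF False] lp by simp
      then have "mseries_mult (sch m) (sch n) a = (\<Sum>q\<in>?P. lr m n q * sch q a)"
        using sch_mult_expansion[OF mn, of k] by simp
      also have "\<dots> = (\<Sum>q\<in>pars_of k. lr m n q * sch q a)"
      proof (rule sum.mono_neutral_right)
        show "pars_of k \<subseteq> ?P" by (rule pars_of_subset) simp
        show "\<forall>q\<in>?P - pars_of k. lr m n q * sch q a = 0"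
        proof
          fix q assume "q \<in> ?P - pars_of k"
          then have "psize q \<noteq> k" by (simp add: mem_pars_le mem_pars_of)
          then show "lr m n q * sch q a = 0" using lr_degree[of m n q] s by auto
        qed
      qed simp
      finally show ?thesis by simp
    qed simp
  qed
  also have "\<dots> = (\<Sum>m\<in>?P. \<Sum>n\<in>?P. \<Sum>q\<in>pars_of k. lr m n l * lr m n q * sch q a)"
    by (simp only: sum_distrib_left mult.assoc)
  also have "\<dots> = (\<Sum>m\<in>?P. \<Sum>q\<in>pars_of k. \<Sum>n\<in>?P. lr m n l * lr m n q * sch q a)"
    by (rule sum.cong[OF refl], rule sum.swap)
  also have "\<dots> = (\<Sum>q\<in>pars_of k. \<Sum>m\<in>?P. \<Sum>n\<in>?P. lr m n l * lr m n q * sch q a)"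
    by (rule sum.swap)
  also have "\<dots> = (\<Sum>q\<in>pars_of k. (\<Sum>m\<in>?P. \<Sum>n\<in>?P. lr m n l * lr m n q) * sch q a)"
    by (simp only: sum_distrib_right)
  finally show ?thesis ..
qed

section \<open>Diagonal entries of the doubling matrix\<close>

lemma exps_filter_split: "exps (filter_mset P a) + exps (filter_mset (\<lambda>x. \<not> P x) a) = exps a"
proof -
  have e: "exps (filter_mset P a) = image_mset (count a) (filter_mset P (mset_set (set_mset a)))" for P
  proof -
    have "exps (filter_mset P a) = image_mset (count (filter_mset P a)) (filter_mset P (mset_set (set_mset a)))"
      by (simp add: exps_def filter_mset_mset_set)
    also have "\<dots> = image_mset (count a) (filter_mset P (mset_set (set_mset a)))"
      by (rule image_mset_cong) simp
    finally show ?thesis .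
  qed
  show ?thesis unfolding e image_mset_union[symmetric] multiset_partition[symmetric] by (simp only: exps_def)
qed

text \<open>The size of \<open>exps\<close> is the number of variables that occur. Equal sizes
  already force \<open>b\<close> and \<open>a - b\<close> to have disjoint supports, so every
  exponent goes undivided to one side.\<close>

lemma submultiset_exps_iff:
  assumes b: "b \<subseteq># a"
  shows "exps (a - b) + exps b = exps a \<longleftrightarrow> b = filter_mset (\<lambda>x. x \<in># b) a"
proof
  assume "exps (a - b) + exps b = exps a"
  then have "size (exps (a - b)) + size (exps b) = size (exps a)" by (metis size_union)
  then have c: "card (set_mset (a - b)) + card (set_mset b) = card (set_mset a)" by (simp only: size_exps)
  have "a = (a - b) + b" using b by simp
  then have "set_mset a = set_mset (a - b) \<union> set_mset b" by (metis set_mset_union)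
  then have "card (set_mset (a - b) \<inter> set_mset b) = 0"
    using card_Un_Int[of "set_mset (a - b)" "set_mset b"] c by simp
  then have disj: "set_mset (a - b) \<inter> set_mset b = {}" by simp
  show "b = filter_mset (\<lambda>x. x \<in># b) a"
  proof (rule multiset_eqI)
    fix x
    show "count b x = count (filter_mset (\<lambda>x. x \<in># b) a) x"
    proof (cases "x \<in># b")
      case True
      then have "x \<notin># a - b" using disj by blast
      then have "count (a - b) x = 0" by (simp only: not_in_iff)
      then show ?thesis using True mset_subset_eq_count[OF b, of x] by simp
    next
      case False
      then show ?thesis by (auto simp: count_eq_zero_iff)
    qed
  qed
next
  assume b': "b = filter_mset (\<lambda>x. x \<in># b) a"
  have "a - b = filter_mset (\<lambda>x. x \<notin># b) a"
  proof (rule multiset_eqI)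
    fix x
    have "count b x = (if x \<in># b then count a x else 0)" by (subst (1) b') simp
    then show "count (a - b) x = count (filter_mset (\<lambda>x. x \<notin># b) a) x" by simp
  qed
  then have "exps (a - b) + exps b = exps (filter_mset (\<lambda>x. x \<notin># b) a) + exps (filter_mset (\<lambda>x. x \<in># b) a)"
    using b' by simp
  also have "\<dots> = exps a" using exps_filter_split[of "\<lambda>x. x \<in># b" a] by (simp only: add.commute)
  finally show "exps (a - b) + exps b = exps a" .
qed

lemma doubling_self: "doubling q (shape_mset q) = 2 ^ size (exps (shape_mset q))"
proof -
  let ?a = "shape_mset q"
  have "doubling q ?a = int (card {b \<in> {b. b \<subseteq># ?a}. exps ?a = exps (?a - b) + exps b})"
    unfolding doubling_def by (rule sum_of_bool_card) simp
  also have "{b \<in> {b. b \<subseteq># ?a}. exps ?a = exps (?a - b) + exps b} =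
    (\<lambda>B. filter_mset (\<lambda>x. x \<in> B) ?a) ` Pow (set_mset ?a)" (is "?L = ?f ` _")
  proof (intro equalityI subsetI)
    fix b assume "b \<in> ?L"
    then have b: "b \<subseteq># ?a" "exps (?a - b) + exps b = exps ?a" by simp_all
    then have "b = ?f (set_mset b)" using submultiset_exps_iff[OF b(1)] by blast
    moreover have "set_mset b \<in> Pow (set_mset ?a)" using set_mset_mono[OF b(1)] by simp
    ultimately show "b \<in> ?f ` Pow (set_mset ?a)" by (rule image_eqI)
  next
    fix b assume "b \<in> ?f ` Pow (set_mset ?a)"
    then obtain B where B: "b = ?f B" "B \<subseteq> set_mset ?a" by auto
    have sb: "b \<subseteq># ?a" using B(1) by simp
    have "set_mset b = B" using B by auto
    then have "b = filter_mset (\<lambda>x. x \<in># b) ?a" using B(1) by simp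
    then show "b \<in> ?L" using submultiset_exps_iff[OF sb] sb by simp
  qed
  also have "card (?f ` Pow (set_mset ?a)) = card (Pow (set_mset ?a))"
  proof (rule card_image, rule inj_onI)
    fix B C assume BC: "B \<in> Pow (set_mset ?a)" "C \<in> Pow (set_mset ?a)" "?f B = ?f C"
    have "set_mset (?f B) = B" "set_mset (?f C) = C" using BC(1,2) by auto
    then show "B = C" using BC(3) by metis
  qed
  finally show ?thesis by (simp add: card_Pow size_exps)
qed

text \<open>At partition monomials \<open>doubled_schur\<close> reads \<open>M K = K A\<close> with
  \<open>K\<close> the Kostka matrix. The diagonal of \<open>M\<close> consists of sums of squares,
  and that of \<open>A\<close> is given by \<open>doubling_self\<close>.\<close>

lemma sum_lr_squares:
  "(\<Sum>l\<in>pars_of k. \<Sum>m\<in>pars_le k. \<Sum>n\<in>pars_le k. (lr m n l)\<^sup>2) =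
    (\<Sum>q\<in>pars_of k. 2 ^ size (exps (shape_mset q)))"
proof -
  have "(\<Sum>l\<in>pars_of k. \<Sum>m\<in>pars_le k. \<Sum>n\<in>pars_le k. lr m n l * lr m n l) =
    (\<Sum>q\<in>pars_of k. doubling q (shape_mset q))"
  proof (rule trace_conjugate[where K = "\<lambda>p q. sch p (shape_mset q)" and L = "kostka_inverse k"
        and M = "\<lambda>l q. \<Sum>m\<in>pars_le k. \<Sum>n\<in>pars_le k. lr m n l * lr m n q"
        and A = "\<lambda>p q. doubling p (shape_mset q)"])
    fix p q assume pq: "p \<in> pars_of k" "q \<in> pars_of k"
    show "(\<Sum>x\<in>pars_of k. sch p (shape_mset x) * kostka_inverse k x q) = of_bool (p = q)"
      using kostka_inverse(1)[of k] pq by blast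
    show "(\<Sum>x\<in>pars_of k. kostka_inverse k p x * sch x (shape_mset q)) = of_bool (p = q)"
      using kostka_inverse(2)[of k] pq by blast
    show "(\<Sum>x\<in>pars_of k. (\<Sum>m\<in>pars_le k. \<Sum>n\<in>pars_le k. lr m n p * lr m n x) * sch x (shape_mset q)) =
      (\<Sum>x\<in>pars_of k. sch p (shape_mset x) * doubling x (shape_mset q))"
      by (rule doubled_schur[OF pq(1)]) (use pq(2) in \<open>simp add: mem_pars_of size_shape_mset\<close>)
  qed simp
  then show ?thesis by (simp only: power2_eq_square doubling_self)
qed

section \<open>The generating function\<close>

text \<open>The bound \<open>m\<close> on the parts corresponds to keeping the first
  \<open>m\<close> factors of the product.\<close>

definition part_msets :: "nat \<Rightarrow> nat \<Rightarrow> nat multiset set" where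
  "part_msets m n = {M. set_mset M \<subseteq> {1..m} \<and> sum_mset M = n}"

definition part_weight :: "nat \<Rightarrow> nat \<Rightarrow> int" where
  "part_weight m n = (\<Sum>M\<in>part_msets m n. 2 ^ size M)"

lemma part_msets_subset: "part_msets m n \<subseteq> (\<lambda>q. exps (shape_mset q)) ` pars_of n"
proof
  fix M assume M: "M \<in> part_msets m n"
  then have "0 \<notin># M" by (auto simp: part_msets_def)
  then obtain q where "q \<in> pars_of (sum_mset M)" "exps (shape_mset q) = M" by (rule exps_shape_ex)
  then show "M \<in> (\<lambda>q. exps (shape_mset q)) ` pars_of n"
    using M by (intro image_eqI[of M _ q]) (simp_all add: part_msets_def)
qed

lemma finite_part_msets [simp]: "finite (part_msets m n)"
  by (rule finite_subset[OF part_msets_subset]) simp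

lemma member_le_sum_mset: "x \<in># M \<Longrightarrow> x \<le> sum_mset (M :: nat multiset)"
  by (auto elim: mset_add)

lemma part_msets_full:
  assumes "n \<le> m"
  shows "part_msets m n = (\<lambda>q. exps (shape_mset q)) ` pars_of n"
proof (rule equalityI[OF part_msets_subset], rule image_subsetI)
  fix q assume q: "q \<in> pars_of n"
  have s: "sum_mset (exps (shape_mset q)) = n" using q by (simp add: mem_pars_of size_shape_mset)
  have "x \<in> {1..m}" if x: "x \<in># exps (shape_mset q)" for x
  proof -
    have "x \<noteq> 0" using x zero_notin_exps[of "shape_mset q"] by (cases x) simp_all
    moreover have "x \<le> n" using member_le_sum_mset[OF x] s by simp
    ultimately show ?thesis using assms by simp
  qed
  then show "exps (shape_mset q) \<in> part_msets m n" using s by (auto simp: part_msets_def)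
qed

lemma part_weight_full:
  assumes "n \<le> m"
  shows "part_weight m n = (\<Sum>q\<in>pars_of n. 2 ^ size (exps (shape_mset q)))"
proof -
  have "inj_on (\<lambda>q. exps (shape_mset q)) (pars_of n)"
    by (rule inj_onI, rule exps_shape_inj) (simp_all add: mem_pars_of)
  then show ?thesis unfolding part_weight_def part_msets_full[OF assms] by (simp add: sum.reindex)
qed

lemma part_msets_Suc:
  "part_msets (Suc m) n = part_msets m n \<union>
     (if Suc m \<le> n then add_mset (Suc m) ` part_msets (Suc m) (n - Suc m) else {})" (is "_ = ?R")
proof (intro equalityI subsetI)
  fix M assume "M \<in> part_msets (Suc m) n"
  then have M: "set_mset M \<subseteq> {1..Suc m}" "sum_mset M = n" by (simp_all add: part_msets_def)
  show "M \<in> ?R"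
  proof (cases "Suc m \<in># M")
    case True
    then obtain M' where M': "M = add_mset (Suc m) M'" by (rule mset_add)
    then have "Suc m \<le> n" "M' \<in> part_msets (Suc m) (n - Suc m)"
      using M by (auto simp: part_msets_def)
    then show ?thesis using M' by simp
  next
    case False
    have "x \<in> {1..m}" if "x \<in># M" for x
    proof -
      have "x \<noteq> Suc m" using that False by blast
      moreover have "x \<in> {1..Suc m}" using that M(1) by blast
      ultimately show ?thesis by simp
    qed
    then show ?thesis using M(2) by (auto simp: part_msets_def)
  qed
next
  fix M assume "M \<in> ?R"
  then consider "M \<in> part_msets m n"
    | M' where "Suc m \<le> n" "M = add_mset (Suc m) M'" "M' \<in> part_msets (Suc m) (n - Suc m)"
    by (auto split: if_splits)
  then show "M \<in> part_msets (Suc m) n"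
  proof cases
    case 1
    then have "set_mset M \<subseteq> {1..m}" "sum_mset M = n" by (simp_all add: part_msets_def)
    moreover have "{1..m} \<subseteq> {1..Suc m}" by simp
    ultimately show ?thesis unfolding part_msets_def by blast
  next
    case 2
    then show ?thesis by (simp add: part_msets_def)
  qed
qed

text \<open>Either no part equals \<open>Suc m\<close>, or one such part is removed at the price of
  a factor 2. Further parts \<open>Suc m\<close> may remain, so this is multiplication by
  \<open>1 - 2 * fps_X ^ Suc m\<close> read off coefficientwise.\<close>

lemma part_weight_Suc:
  "part_weight (Suc m) n = part_weight m n + (if Suc m \<le> n then 2 * part_weight (Suc m) (n - Suc m) else 0)"
proof (cases "Suc m \<le> n")
  case True
  let ?B = "add_mset (Suc m) ` part_msets (Suc m) (n - Suc m)"
  have disj: "part_msets m n \<inter> ?B = {}"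
  proof (rule equals0I)
    fix M assume M: "M \<in> part_msets m n \<inter> ?B"
    then have "Suc m \<in># M" by auto
    moreover have "set_mset M \<subseteq> {1..m}" using M by (simp add: part_msets_def)
    ultimately have "Suc m \<in> {1..m}" by blast
    then show False by simp
  qed
  have "part_msets (Suc m) n = part_msets m n \<union> ?B"
    using part_msets_Suc[of m n] True by (simp only: if_True)
  then have "part_weight (Suc m) n = (\<Sum>M\<in>part_msets m n \<union> ?B. 2 ^ size M)"
    unfolding part_weight_def by (rule arg_cong)
  also have "\<dots> = part_weight m n + (\<Sum>M\<in>?B. 2 ^ size M)"
    unfolding part_weight_def
    by (rule sum.union_disjoint[OF finite_part_msets finite_imageI[OF finite_part_msets] disj])
  also have "(\<Sum>M\<in>?B. 2 ^ size M) = (\<Sum>M\<in>part_msets (Suc m) (n - Suc m). 2 * 2 ^ size M :: int)"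
    by (subst sum.reindex) (simp_all add: inj_on_def)
  also have "\<dots> = 2 * part_weight (Suc m) (n - Suc m)"
    unfolding part_weight_def by (rule sum_distrib_left[symmetric])
  finally show ?thesis by (simp only: True if_True)
next
  case False
  then have "part_msets (Suc m) n = part_msets m n"
    using part_msets_Suc[of m n] by (simp only: if_False Un_empty_right)
  then show ?thesis using False by (simp only: part_weight_def if_False add_0_right)
qed

lemma part_weight_0: "part_weight 0 n = of_bool (n = 0)"
proof -
  have "part_msets 0 n = (if n = 0 then {{#}} else {})" by (auto simp: part_msets_def)
  then show ?thesis by (simp add: part_weight_def)
qed

section \<open>The infinite product as a limit of truncations\<close>

lemma prod_recip: "(\<Prod>i<m. fps_recip (1 - 2 * fps_X ^ Suc i)) = Abs_fps (part_weight m)"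
proof (induction m)
  case 0
  show ?case by (simp add: fps_eq_iff part_weight_0)
next
  case (Suc m)
  let ?d = "1 - 2 * fps_X ^ Suc m :: int fps"
  have inv: "?d * fps_recip ?d = 1" by (rule fps_recip) simp
  have "Abs_fps (part_weight (Suc m)) * ?d = Abs_fps (part_weight m)"
  proof (rule fps_ext)
    fix n
    have "Abs_fps (part_weight (Suc m)) * ?d =
      Abs_fps (part_weight (Suc m)) - fps_const 2 * (fps_X ^ Suc m * Abs_fps (part_weight (Suc m)))"
      by (simp add: algebra_simps numeral_fps_const)
    then have "fps_nth (Abs_fps (part_weight (Suc m)) * ?d) n =
      part_weight (Suc m) n - 2 * (if n < Suc m then 0 else part_weight (Suc m) (n - Suc m))"
      by (simp only: fps_sub_nth fps_mult_left_const_nth fps_X_power_mult_nth fps_nth_Abs_fps)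
    also have "\<dots> = part_weight m n" using part_weight_Suc[of m n] by simp
    finally show "fps_nth (Abs_fps (part_weight (Suc m)) * ?d) n = fps_nth (Abs_fps (part_weight m)) n"
      by simp
  qed
  then have "(\<Prod>i<Suc m. fps_recip (1 - 2 * fps_X ^ Suc i)) = Abs_fps (part_weight (Suc m)) * ?d * fps_recip ?d"
    using Suc.IH by (simp only: prod.lessThan_Suc)
  also have "\<dots> = Abs_fps (part_weight (Suc m))" by (simp only: mult.assoc inv mult_1_right)
  finally show ?case .
qed

definition parts_gf :: "int fps" where
  "parts_gf = Abs_fps (\<lambda>n. \<Sum>q\<in>pars_of n. 2 ^ size (exps (shape_mset q)))"

text \<open>For power series, convergence follows once each coefficient is eventually constant, and
  parts larger than \<open>k\<close> cannot occur in a partition of \<open>k\<close>.\<close>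

lemma raw_has_prod_parts_gf: "raw_has_prod (\<lambda>k. fps_recip (1 - 2 * fps_X ^ Suc k)) 0 parts_gf"
  unfolding raw_has_prod_def
proof
  show "(\<lambda>n. \<Prod>i\<le>n. fps_recip (1 - 2 * fps_X ^ Suc (i + 0))) \<longlonglongrightarrow> parts_gf"
  proof (rule tendsto_fpsI)
    fix k
    show "\<forall>\<^sub>F n in sequentially. fps_nth (\<Prod>i\<le>n. fps_recip (1 - 2 * fps_X ^ Suc (i + 0))) k = fps_nth parts_gf k"
      using eventually_ge_at_top[of k]
    proof eventually_elim
      case (elim n)
      have eq: "(\<Prod>i\<le>n. fps_recip (1 - 2 * fps_X ^ Suc (i + 0))) = Abs_fps (part_weight (Suc n))"
        unfolding lessThan_Suc_atMost[symmetric] add_0_right by (rule prod_recip)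
      show ?case
        unfolding eq parts_gf_def fps_nth_Abs_fps by (rule part_weight_full) (use elim in simp)
    qed
  qed
  \<comment> \<open>Convergence of an infinite product includes that the limit is nonzero; the
    constant term shows it.\<close>
  have "fps_nth parts_gf 0 = 1"
    using part_weight_full[of 0 0] by (simp add: parts_gf_def part_weight_0)
  then show "parts_gf \<noteq> 0" by auto
qed

section \<open>Schur expansions\<close>

lemma diagram_eq_diag: "diagram l = diag (row l)"
proof (rule set_eqI)
  fix c :: "nat \<times> nat"
  obtain i j where c: "c = (i, j)" by (cases c)
  show "c \<in> diagram l \<longleftrightarrow> c \<in> diag (row l)"
    unfolding c by (cases "i < length l") (simp_all add: diagram_def row_def)
qed

lemma schur_eq_sch: "schur l = sch (row l)"
  by (rule ext) (simp only: schur_def sch_def ssyt_def tableaux_def content_def diagram_eq_diag)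

text \<open>Linear independence by a minimal counterexample. Among the partitions where the
  coefficients differ, one of least entry sum is chosen; at its own monomial
  \<open>sch_triangular\<close> kills every other differing term. This justifies the definite
  description in \<open>lr_coeff\<close>.\<close>

lemma schur_expansion_unique:
  assumes c: "schur_expansion f c" and d: "schur_expansion f d"
  shows "c = d"
proof (rule ccontr)
  assume ne: "c \<noteq> d"
  define U where "U = {l. c l \<noteq> 0} \<union> {l. d l \<noteq> 0}"
  have U: "finite U" "U \<subseteq> partitions" using c d unfolding U_def schur_expansion_def by blast+
  have sums: "(\<Sum>l\<in>U. c l * schur l a) = (\<Sum>l\<in>U. d l * schur l a)" for a
  proof -
    have "(\<Sum>l\<in>U. c l * schur l a) = (\<Sum>l | c l \<noteq> 0. c l * schur l a)"
      by (rule sum.mono_neutral_right[OF U(1)]) (simp_all add: U_def)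
    also have "\<dots> = f a" using c unfolding schur_expansion_def by metis
    also have "\<dots> = (\<Sum>l | d l \<noteq> 0. d l * schur l a)" using d unfolding schur_expansion_def by metis
    also have "\<dots> = (\<Sum>l\<in>U. d l * schur l a)"
      by (rule sum.mono_neutral_left[OF U(1)]) (simp_all add: U_def)
    finally show ?thesis .
  qed
  define S where "S = {l \<in> U. c l \<noteq> d l}"
  have finS: "finite S" using U(1) by (simp add: S_def)
  obtain l where "c l \<noteq> d l" using ne by blast
  then have "l \<in> S" by (auto simp: S_def U_def)
  then have neS: "S \<noteq> {}" by blast
  let ?r = "\<lambda>l. sum_mset (shape_mset (row l))"
  define l0 where "l0 = arg_min_on ?r S"
  have l0: "l0 \<in> S" unfolding l0_def by (rule arg_min_if_finite(1)[OF finS neS])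
  have min: "\<not> ?r l < ?r l0" if "l \<in> S" for l
    using arg_min_if_finite(2)[OF finS neS, of ?r] that unfolding l0_def by blast
  have l0U: "l0 \<in> U" "c l0 \<noteq> d l0" using l0 by (simp_all add: S_def)
  have l0P: "l0 \<in> partitions" using l0U(1) U(2) by blast
  let ?a = "shape_mset (row l0)"
  have zero: "(c l - d l) * schur l ?a = (if l = l0 then c l0 - d l0 else 0)" if l: "l \<in> U" for l
  proof (cases "l = l0")
    case True
    then show ?thesis using sch_shape_mset_self[OF row_pars[OF l0P]] by (simp add: schur_eq_sch)
  next
    case False
    have lP: "l \<in> partitions" using l U(2) by blast
    have "c l = d l \<or> schur l ?a = 0"
    proof (rule ccontr)
      assume "\<not> (c l = d l \<or> schur l ?a = 0)"
      then have "l \<in> S" "sch (row l) ?a \<noteq> 0" using l by (simp_all add: S_def schur_eq_sch)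
      then have "row l = row l0"
        using sch_triangular[OF row_pars[OF lP] row_pars[OF l0P]] min[of l] by blast
      then show False using inj_onD[OF row_inj _ lP l0P] False by blast
    qed
    then show ?thesis using False by auto
  qed
  have "(\<Sum>l\<in>U. (c l - d l) * schur l ?a) = 0"
    using sums[of ?a] by (simp only: left_diff_distrib sum_subtractf diff_self)
  moreover have "(\<Sum>l\<in>U. (c l - d l) * schur l ?a) = (\<Sum>l\<in>U. if l = l0 then c l0 - d l0 else 0)"
    by (rule sum.cong) (simp_all only: zero)
  moreover have "\<dots> = c l0 - d l0" using l0U(1) U(1) by simp
  ultimately show False using l0U(2) by simp
qed

section \<open>Agreement with the coefficients defined by expansion\<close>

lemma sum_row_partitions:
  "(\<Sum>l | l \<in> partitions \<and> row l \<in> Q. g (row l)) = (\<Sum>p\<in>pars \<inter> Q. g p)"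
proof (rule sum.reindex_bij_betw)
  show "bij_betw row {l. l \<in> partitions \<and> row l \<in> Q} (pars \<inter> Q)"
  proof (rule bij_betw_imageI)
    show "inj_on row {l. l \<in> partitions \<and> row l \<in> Q}"
      by (rule inj_on_subset[OF row_inj]) blast
    show "row ` {l. l \<in> partitions \<and> row l \<in> Q} = pars \<inter> Q"
    proof (intro equalityI subsetI)
      fix p assume "p \<in> row ` {l. l \<in> partitions \<and> row l \<in> Q}"
      then show "p \<in> pars \<inter> Q" using row_pars by blast
    next
      fix p assume p: "p \<in> pars \<inter> Q"
      then have "p \<in> pars" by blast
      then obtain l where "l \<in> partitions" "row l = p" by (rule row_surj)
      then show "p \<in> row ` {l. l \<in> partitions \<and> row l \<in> Q}" using p by blast
    qed
  qed
qed

lemma finite_partitions_row: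
  assumes "finite Q"
  shows "finite {l. l \<in> partitions \<and> row l \<in> Q}"
proof (rule finite_imageD)
  show "finite (row ` {l. l \<in> partitions \<and> row l \<in> Q})"
    by (rule finite_subset[OF _ assms]) blast
  show "inj_on row {l. l \<in> partitions \<and> row l \<in> Q}"
    by (rule inj_on_subset[OF row_inj]) blast
qed

lemma lr_coeff_eq_lr:
  assumes m: "m \<in> partitions" and n: "n \<in> partitions" and l: "l \<in> partitions"
  shows "lr_coeff l m n = lr (row m) (row n) (row l)"
proof -
  \<comment> \<open>The cut-off matters: \<open>row\<close> ignores trailing zeros, so without it
    lists outside \<open>partitions\<close> could receive nonzero coefficients.\<close>
  define c where "c = (\<lambda>l. if l \<in> partitions then lr (row m) (row n) (row l) else 0)"
  define M where "M = psize (row m) + psize (row n)"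
  let ?F = "{l. l \<in> partitions \<and> row l \<in> pars_le M}"
  have sub: "{l. c l \<noteq> 0} \<subseteq> ?F"
  proof
    fix l assume "l \<in> {l. c l \<noteq> 0}"
    then have l: "l \<in> partitions" "lr (row m) (row n) (row l) \<noteq> 0"
      by (simp_all add: c_def split: if_splits)
    then show "l \<in> ?F" using lr_degree[OF l(2)] row_pars[OF l(1)] by (simp add: mem_pars_le M_def)
  qed
  have "schur_expansion (mseries_mult (schur m) (schur n)) c"
    unfolding schur_expansion_def
  proof (intro conjI)
    show "finite {l. c l \<noteq> 0}" by (rule finite_subset[OF sub]) (rule finite_partitions_row, simp)
    show "{l. c l \<noteq> 0} \<subseteq> partitions" using sub by blast
    show "mseries_mult (schur m) (schur n) = (\<lambda>a. \<Sum>l | c l \<noteq> 0. c l * schur l a)"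
    proof
      fix a
      have "mseries_mult (schur m) (schur n) a = (\<Sum>p\<in>pars_le M. lr (row m) (row n) p * sch p a)"
        unfolding schur_eq_sch sch_mult_expansion[OF row_pars[OF m] row_pars[OF n] order_refl] M_def ..
      also have "pars_le M = pars \<inter> pars_le M" by (auto simp: mem_pars_le)
      also have "(\<Sum>p\<in>pars \<inter> pars_le M. lr (row m) (row n) p * sch p a) =
        (\<Sum>l\<in>?F. lr (row m) (row n) (row l) * sch (row l) a)"
        by (rule sum_row_partitions[symmetric])
      also have "\<dots> = (\<Sum>l\<in>?F. c l * schur l a)"
        by (rule sum.cong) (simp_all add: c_def schur_eq_sch)
      also have "\<dots> = (\<Sum>l | c l \<noteq> 0. c l * schur l a)"
        by (rule sum.mono_neutral_right[OF _ sub]) (simp_all add: finite_partitions_row)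
      finally show "mseries_mult (schur m) (schur n) a = (\<Sum>l | c l \<noteq> 0. c l * schur l a)" .
    qed
  qed
  then have "(THE c. schur_expansion (mseries_mult (schur m) (schur n)) c) = c"
    by (intro the_equality schur_expansion_unique)
  then show ?thesis using l by (simp add: lr_coeff_def c_def)
qed

section \<open>Convergence of the sum over triples\<close>

lemma sum_lr_coeff_squares:
  "(\<Sum>(l, m, n)\<in>{l. l \<in> partitions \<and> row l \<in> pars_of k} \<times>
      {m. m \<in> partitions \<and> row m \<in> pars_le k} \<times> {n. n \<in> partitions \<and> row n \<in> pars_le k}.
      (lr_coeff l m n)\<^sup>2) = fps_nth parts_gf k"
proof -
  let ?P = "{l. l \<in> partitions \<and> row l \<in> pars_of k}" and ?Q = "{l. l \<in> partitions \<and> row l \<in> pars_le k}"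
  have inter: "pars \<inter> pars_of k = pars_of k" "pars \<inter> pars_le k = pars_le k"
    by (auto simp: mem_pars_of mem_pars_le)
  have P: "(\<Sum>l\<in>?P. g (row l)) = (\<Sum>p\<in>pars_of k. g p)"
    and Q: "(\<Sum>l\<in>?Q. g (row l)) = (\<Sum>p\<in>pars_le k. g p)" for g :: "(nat \<Rightarrow> nat) \<Rightarrow> int"
    unfolding sum_row_partitions inter by (rule refl)+
  have "(\<Sum>(l, m, n)\<in>?P \<times> ?Q \<times> ?Q. (lr_coeff l m n)\<^sup>2) =
      (\<Sum>l\<in>?P. \<Sum>m\<in>?Q. \<Sum>n\<in>?Q. (lr_coeff l m n)\<^sup>2)"
    by (simp only: sum.cartesian_product)
  also have "\<dots> = (\<Sum>l\<in>?P. \<Sum>m\<in>?Q. \<Sum>n\<in>?Q. (lr (row m) (row n) (row l))\<^sup>2)"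
    by (intro sum.cong refl) (simp add: lr_coeff_eq_lr)
  also have "\<dots> = (\<Sum>l\<in>?P. \<Sum>m\<in>?Q. \<Sum>n\<in>pars_le k. (lr (row m) n (row l))\<^sup>2)"
    by (rule sum.cong[OF refl], rule sum.cong[OF refl], rule Q)
  also have "\<dots> = (\<Sum>l\<in>?P. \<Sum>m\<in>pars_le k. \<Sum>n\<in>pars_le k. (lr m n (row l))\<^sup>2)"
    by (rule sum.cong[OF refl], rule Q)
  also have "\<dots> = (\<Sum>l\<in>pars_of k. \<Sum>m\<in>pars_le k. \<Sum>n\<in>pars_le k. (lr m n l)\<^sup>2)"
    by (rule P)
  also have "\<dots> = fps_nth parts_gf k" by (simp add: sum_lr_squares parts_gf_def)
  finally show ?thesis .
qed

text \<open>For fixed \<open>k\<close> only finitely many triples matter: \<open>lr_degree\<close>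
  bounds the sizes of \<open>m\<close> and \<open>n\<close> by \<open>k\<close> wherever the
  coefficient is nonzero. The \<open>k\<close>-th coefficient is thus constant on all finite index
  sets containing \<open>?F\<close>.\<close>

lemma has_sum_parts_gf:
  "((\<lambda>(l, m, n). fps_const ((lr_coeff l m n)\<^sup>2) * fps_X ^ sum_list l) has_sum parts_gf)
     (partitions \<times> partitions \<times> partitions)"
  unfolding has_sum_def
proof (rule tendsto_fpsI)
  fix k
  let ?t = "\<lambda>(l, m, n). fps_const ((lr_coeff l m n)\<^sup>2) * fps_X ^ sum_list l :: int fps"
  let ?A = "partitions \<times> partitions \<times> partitions"
  let ?F = "{l. l \<in> partitions \<and> row l \<in> pars_of k} \<times>
      {m. m \<in> partitions \<and> row m \<in> pars_le k} \<times> {n. n \<in> partitions \<and> row n \<in> pars_le k}"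
  have nth: "fps_nth (?t x) k = (case x of (l, m, n) \<Rightarrow> if sum_list l = k then (lr_coeff l m n)\<^sup>2 else 0)" for x
    by (cases x) (simp add: fps_mult_left_const_nth fps_X_power_nth)
  have zero: "fps_nth (?t x) k = 0" if x: "x \<in> ?A - ?F" for x
  proof -
    obtain l m n where lmn: "x = (l, m, n)" by (cases x)
    then have P: "l \<in> partitions" "m \<in> partitions" "n \<in> partitions" using x by blast+
    have "sum_list l = k \<Longrightarrow> lr_coeff l m n = 0"
    proof (rule ccontr)
      assume lk: "sum_list l = k" and "lr_coeff l m n \<noteq> 0"
      then have "psize (row l) = psize (row m) + psize (row n)"
        using lr_degree lr_coeff_eq_lr[OF P(2,3,1)] by simp
      then have "x \<in> ?F" unfolding lmn using P lk
        by (simp add: mem_pars_of mem_pars_le row_pars psize_row)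
      then show False using x by blast
    qed
    then show ?thesis unfolding nth lmn by simp
  qed
  have inF: "fps_nth (?t x) k = (case x of (l, m, n) \<Rightarrow> (lr_coeff l m n)\<^sup>2)" if "x \<in> ?F" for x
    using that unfolding nth by (cases x) (simp add: mem_pars_of psize_row)
  show "\<forall>\<^sub>F F in finite_subsets_at_top ?A. fps_nth (sum ?t F) k = fps_nth parts_gf k"
    unfolding eventually_finite_subsets_at_top
  proof (intro exI conjI allI impI)
    show "finite ?F" by (intro finite_cartesian_product finite_partitions_row) simp_all
    show "?F \<subseteq> ?A" by blast
    fix F assume F: "finite F \<and> ?F \<subseteq> F \<and> F \<subseteq> ?A"
    have "fps_nth (sum ?t F) k = (\<Sum>x\<in>F. fps_nth (?t x) k)" by (rule fps_sum_nth)
    also have "\<dots> = (\<Sum>x\<in>?F. fps_nth (?t x) k)"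
    proof (rule sum.mono_neutral_right)
      show "finite F" "?F \<subseteq> F" using F by blast+
      show "\<forall>x\<in>F - ?F. fps_nth (?t x) k = 0" using zero F by blast
    qed
    also have "\<dots> = (\<Sum>x\<in>?F. case x of (l, m, n) \<Rightarrow> (lr_coeff l m n)\<^sup>2)"
      by (rule sum.cong[OF refl]) (rule inF)
    also have "\<dots> = fps_nth parts_gf k" by (rule sum_lr_coeff_squares)
    finally show "fps_nth (sum ?t F) k = fps_nth parts_gf k" .
  qed
qed

theorem theorem4p1:
  "convergent_prod (\<lambda>k. fps_recip (1 - 2 * fps_X ^ Suc k)) \<and>
   ((\<lambda>(l, m, n). fps_const ((lr_coeff l m n)\<^sup>2) * fps_X ^ sum_list l)
      has_sum (\<Prod>k. fps_recip (1 - 2 * fps_X ^ Suc k)))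
     (partitions \<times> partitions \<times> partitions)"
proof
  show "convergent_prod (\<lambda>k. fps_recip (1 - 2 * fps_X ^ Suc k))"
    unfolding convergent_prod_def using raw_has_prod_parts_gf by blast
  have "parts_gf = (\<Prod>k. fps_recip (1 - 2 * fps_X ^ Suc k))"
    by (rule has_prod_unique) (simp only: has_prod_def raw_has_prod_parts_gf simp_thms)
  then show "((\<lambda>(l, m, n). fps_const ((lr_coeff l m n)\<^sup>2) * fps_X ^ sum_list l)
      has_sum (\<Prod>k. fps_recip (1 - 2 * fps_X ^ Suc k)))
     (partitions \<times> partitions \<times> partitions)"
    using has_sum_parts_gf by simp
qed

end
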